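(* Let $A$ be a closed densely defined symmetric operator with equal deficiency indices in a separable Hilbert space $\mathfrak H$, and let $\widetilde A$ be a proper extension of $A$ (i.e. $A\subset\widetilde A\subset A^*$). Suppose there are two points $z_1,z_2\in\rho(\widetilde A)$ with $\operatorname{Im}z_1\cdot\operatorname{Im}z_2<0$. Then $\widetilde A$ is an almost solvable extension of $A$.
   Context: $[\mathcal H]$ denotes the bounded everywhere defined linear operators on a Hilbert space $\mathcal H$; $\rho(\cdot)$ is the resolvent set. A boundary triplet for $A^*$ is a triple $\{\mathcal H,\Gamma_0,\Gamma_1\}$, where $\mathcal H$ is a Hilbert space and $\Gamma_0,\Gamma_1:\operatorname{dom}(A^* )\to\mathcal H$ are linear maps such that (i) $(A^*f,g)_{\mathfrak H}-(f,A^*g)_{\mathfrak H}=(\Gamma_1f,\Gamma_0g)_{\mathcal H}-(\Gamma_0f,\Gamma_1g)_{\mathcal H}$ for all $f,g\in\operatorname{dom}(A^* )$, and (ii) $f\mapsto(\Gamma_1f,\Gamma_0f)$ maps $\operatorname{dom}(A^* )$ onto $\mathcal H\oplus\mathcal H$. A proper extension $\widetilde A$ of $A$ is called almost solvable if there exist a boundary triplet $\{\mathcal H,\Gamma_0,\Gamma_1\}$ for $A^*$ and an operator $B\in[\mathcal H]$ such that $\operatorname{dom}(\widetilde A)=\{f\in\operatorname{dom}(A^* ):\Gamma_1f=B\Gamma_0f\}$. *)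

theory Defs
  imports "HOL-Algebra.Algebraic_Closure_Type" "HOL-Analysis.Analysis"
begin

section \<open>Complex Hilbert spaces as a type class\<close>

text \<open>The real inner product of the library supplies norm and topology. The class adds the complex
  structure, the real inner product being the real part of the complex one. The complex inner
  product is linear in its first argument.\<close>

class complex_inner = real_inner +
  fixes scaleC :: "complex \<Rightarrow> 'a \<Rightarrow> 'a" (infixr \<open>*\<^sub>C\<close> 75)
    and cinner :: "'a \<Rightarrow> 'a \<Rightarrow> complex"
  assumes scaleC_add_right: "c *\<^sub>C (x + y) = c *\<^sub>C x + c *\<^sub>C y"
    and scaleC_add_left: "(c + d) *\<^sub>C x = c *\<^sub>C x + d *\<^sub>C x"
    and scaleC_scaleC: "c *\<^sub>C d *\<^sub>C x = (c * d) *\<^sub>C x"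
    and scaleC_of_real: "complex_of_real r *\<^sub>C x = r *\<^sub>R x"
    and cinner_commute: "cinner x y = cnj (cinner y x)"
    and cinner_add_left: "cinner (x + y) z = cinner x z + cinner y z"
    and cinner_scaleC_left: "cinner (c *\<^sub>C x) y = c * cinner x y"
    and Re_cinner: "Re (cinner x y) = inner x y"

class complex_hilbert = complex_inner + complete_space

instantiation complex :: complex_hilbert
begin
definition scaleC_complex :: "complex \<Rightarrow> complex \<Rightarrow> complex"
  where "scaleC_complex c x = c * x"
definition cinner_complex :: "complex \<Rightarrow> complex \<Rightarrow> complex"
  where "cinner_complex x y = x * cnj y"
instance
  by standard (auto simp: scaleC_complex_def cinner_complex_def inner_complex_def algebra_simps
      scaleR_conv_of_real)
end

instantiation prod :: (complex_inner, complex_inner) complex_inner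
begin
definition scaleC_prod :: "complex \<Rightarrow> 'a \<times> 'b \<Rightarrow> 'a \<times> 'b"
  where "scaleC_prod c x = (c *\<^sub>C fst x, c *\<^sub>C snd x)"
definition cinner_prod :: "'a \<times> 'b \<Rightarrow> 'a \<times> 'b \<Rightarrow> complex"
  where "cinner_prod x y = cinner (fst x) (fst y) + cinner (snd x) (snd y)"
instance
proof
  fix x y :: "'a \<times> 'b"
  show "cinner x y = cnj (cinner y x)"
    unfolding cinner_prod_def complex_cnj_add
    using cinner_commute[of "fst x" "fst y"] cinner_commute[of "snd x" "snd y"] by simp
qed (simp_all add: scaleC_prod_def cinner_prod_def inner_prod_def scaleC_add_right
      scaleC_add_left scaleC_scaleC scaleC_of_real cinner_add_left cinner_scaleC_left
      Re_cinner algebra_simps scaleR_prod_def)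
end

instance prod :: (complex_hilbert, complex_hilbert) complex_hilbert ..

lemma scaleC_one [simp]: "1 *\<^sub>C x = (x :: 'a::complex_inner)"
  using scaleC_of_real[of 1 x] by simp

global_interpretation complex_vector:
  vector_space "scaleC :: complex \<Rightarrow> 'a \<Rightarrow> 'a::complex_inner"
  by standard (simp_all add: scaleC_add_right scaleC_add_left scaleC_scaleC)


section \<open>Unbounded operators\<close>

text \<open>A partially defined operator is identified with its graph, a set of pairs \<open>(f, T f)\<close> with
  \<open>f\<close> in the domain \<open>Domain T\<close>, so that inclusion of operators is inclusion of sets.\<close>

type_synonym 'a operator = "('a \<times> 'a) set"

definition linear_operator :: "'a::complex_inner operator \<Rightarrow> bool"
  where "linear_operator T \<longleftrightarrow> complex_vector.subspace T \<and> single_valued T"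

definition densely_defined :: "'a::complex_inner operator \<Rightarrow> bool"
  where "densely_defined T \<longleftrightarrow> closure (Domain T) = UNIV"

definition symmetric_operator :: "'a::complex_inner operator \<Rightarrow> bool"
  where "symmetric_operator T \<longleftrightarrow>
    (\<forall>(f, f') \<in> T. \<forall>(g, g') \<in> T. cinner f' g = cinner f g')"

text \<open>This is the graph of an operator exactly when \<open>T\<close> is densely defined.\<close>

definition adjoint_op :: "'a::complex_inner operator \<Rightarrow> 'a operator"
  where "adjoint_op T = {(g, g'). \<forall>(f, f') \<in> T. cinner f' g = cinner f g'}"

definition bounded_clinear :: "('a::complex_inner \<Rightarrow> 'a) \<Rightarrow> bool"
  where "bounded_clinear R \<longleftrightarrow> bounded_linear R \<and> (\<forall>c x. R (c *\<^sub>C x) = c *\<^sub>C R x)"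

text \<open>The left-hand side of the equation is the inverse relation of \<open>T - z\<close>, the right-hand side the
  graph of the everywhere defined operator \<open>R\<close>.\<close>

definition resolvent_set :: "'a::complex_inner operator \<Rightarrow> complex set"
  where "resolvent_set T =
    {z. \<exists>R. bounded_clinear R \<and> {(f' - z *\<^sub>C f, f) | f f'. (f, f') \<in> T} = {(h, R h) | h. True}}"

definition defect_space :: "'a::complex_inner operator \<Rightarrow> complex \<Rightarrow> 'a set"
  where "defect_space A z = {f. (f, z *\<^sub>C f) \<in> adjoint_op A}"

text \<open>The library dimension \<open>dim\<close> is \<open>0\<close> for subspaces of infinite dimension, hence the case
  distinction. In a separable space this agrees with the Hilbert space dimension when the infinite
  cardinal is written \<open>\<infinity>\<close>.\<close>

definition ecdim :: "'a::complex_inner set \<Rightarrow> enat"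
  where "ecdim S = (if \<exists>B. finite B \<and> S \<subseteq> complex_vector.span B
    then enat (complex_vector.dim S) else \<infinity>)"

definition deficiency_index_plus :: "'a::complex_inner operator \<Rightarrow> enat"
  where "deficiency_index_plus A = ecdim (defect_space A \<i>)"

definition deficiency_index_minus :: "'a::complex_inner operator \<Rightarrow> enat"
  where "deficiency_index_minus A = ecdim (defect_space A (- \<i>))"

definition proper_extension :: "'a::complex_inner operator \<Rightarrow> 'a operator \<Rightarrow> bool"
  where "proper_extension A T \<longleftrightarrow> linear_operator T \<and> A \<subseteq> T \<and> T \<subseteq> adjoint_op A"


section \<open>Hilbert spaces with explicit carrier\<close>

text \<open>The space of boundary values is existentially quantified, so it cannot be a type. It is a
  complex module in the sense of HOL-Algebra together with a complete inner product. The
  multiplicative components inherited from the ring record play no role.\<close>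

record 'b ip_space = "(complex, 'b) module" +
  ip :: "'b \<Rightarrow> 'b \<Rightarrow> complex"

definition hnorm :: "'b ip_space \<Rightarrow> 'b \<Rightarrow> real"
  where "hnorm H x = sqrt (Re (ip H x x))"

locale hilbert_space = Module.module "ring_of_type_algebra :: complex ring" H
  for H :: "'b ip_space" (structure) +
  assumes ip_commute: "\<lbrakk>x \<in> carrier H; y \<in> carrier H\<rbrakk> \<Longrightarrow> ip H x y = cnj (ip H y x)"
    and ip_add_left: "\<lbrakk>x \<in> carrier H; y \<in> carrier H; z \<in> carrier H\<rbrakk> \<Longrightarrow>
      ip H (x \<oplus> y) z = ip H x z + ip H y z"
    and ip_smult_left: "\<lbrakk>x \<in> carrier H; y \<in> carrier H\<rbrakk> \<Longrightarrow> ip H (c \<odot> x) y = c * ip H x y"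
    and ip_pos: "\<lbrakk>x \<in> carrier H; x \<noteq> \<zero>\<rbrakk> \<Longrightarrow> 0 < Re (ip H x x)"
    and complete: "\<lbrakk>\<And>n::nat. s n \<in> carrier H;
      \<And>e. 0 < e \<Longrightarrow> \<exists>N. \<forall>m\<ge>N. \<forall>n\<ge>N. hnorm H (s m \<ominus> s n) < e\<rbrakk> \<Longrightarrow>
      \<exists>x\<in>carrier H. (\<lambda>n. hnorm H (s n \<ominus> x)) \<longlonglongrightarrow> 0"

definition inherited :: "'a::complex_inner set \<Rightarrow> 'a ip_space"
  where "inherited S = \<lparr>carrier = S, monoid.mult = undefined, one = undefined, zero = 0,
    add = (+), module.smult = scaleC, ip = cinner\<rparr>"

text \<open>The type class and the locale agree: closed subspaces of a type of the class, in particular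
  the whole type, are Hilbert spaces in the sense of the locale.\<close>

lemma hilbert_space_inherited:
  fixes S :: "'a::complex_hilbert set"
  assumes S: "complex_vector.subspace S" and "closed S"
  shows "hilbert_space (inherited S)"
proof -
  have m: "Module.module (ring_of_type_algebra :: complex ring) (inherited S)"
  proof (rule moduleI)
    show "cring (ring_of_type_algebra :: complex ring)"
      by (rule cring_from_type_algebra)
    show "abelian_group (inherited S)"
    proof (rule abelian_groupI)
      fix x assume "x \<in> carrier (inherited S)"
      then show "\<exists>y\<in>carrier (inherited S). y \<oplus>\<^bsub>inherited S\<^esub> x = \<zero>\<^bsub>inherited S\<^esub>"
        using complex_vector.subspace_neg[OF S] by (intro bexI[of _ "- x"]) (auto simp: inherited_def)
    qed (use S in \<open>auto simp: inherited_def algebra_simps complex_vector.subspace_0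
        complex_vector.subspace_add\<close>)
  qed (use S in \<open>auto simp: inherited_def ring_of_type_algebra_def complex_vector.subspace_scale
      scaleC_add_left scaleC_add_right scaleC_scaleC\<close>)
  interpret N: Module.module "ring_of_type_algebra :: complex ring" "inherited S"
    by (rule m)
  have minus: "x \<ominus>\<^bsub>inherited S\<^esub> y = x - y" if "y \<in> S" for x y
  proof -
    have "\<ominus>\<^bsub>inherited S\<^esub> y = - y"
      by (rule N.M.minus_equality)
        (use that complex_vector.subspace_neg[OF S] in \<open>auto simp: inherited_def\<close>)
    then show ?thesis by (simp add: a_minus_def) (simp add: inherited_def)
  qed
  have norm: "hnorm (inherited S) x = norm x" for x
    by (simp add: hnorm_def inherited_def Re_cinner norm_eq_sqrt_inner)
  have car: "carrier (inherited S) = S" by (simp add: inherited_def)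
  show ?thesis
  proof
    fix x y assume "x \<in> carrier (inherited S)" "y \<in> carrier (inherited S)"
    show "ip (inherited S) x y = cnj (ip (inherited S) y x)"
      by (simp add: inherited_def cinner_commute[symmetric])
  next
    fix s :: "nat \<Rightarrow> 'a"
    assume s: "\<And>n. s n \<in> carrier (inherited S)"
      and C: "\<And>e. 0 < e \<Longrightarrow> \<exists>N. \<forall>m\<ge>N. \<forall>n\<ge>N. hnorm (inherited S) (s m \<ominus>\<^bsub>inherited S\<^esub> s n) < e"
    have "Cauchy s"
      by (rule CauchyI) (use C s in \<open>simp add: norm minus car\<close>)
    then obtain x where x: "s \<longlonglongrightarrow> x"
      by (auto simp: Cauchy_convergent_iff convergent_def)
    then have "x \<in> S"
      using \<open>closed S\<close> s by (auto simp: closed_sequential_limits car)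
    moreover have "(\<lambda>n. norm (s n - x)) \<longlonglongrightarrow> 0"
      using x by (simp add: LIM_zero_iff tendsto_norm_zero_iff)
    ultimately show "\<exists>x\<in>carrier (inherited S). (\<lambda>n. hnorm (inherited S) (s n \<ominus>\<^bsub>inherited S\<^esub> x)) \<longlonglongrightarrow> 0"
      by (auto simp: norm minus car)
  qed (auto simp: inherited_def cinner_add_left cinner_scaleC_left Re_cinner)
qed

definition bounded_operator_on :: "'b ip_space \<Rightarrow> ('b \<Rightarrow> 'b) \<Rightarrow> bool"
  where "bounded_operator_on H B \<longleftrightarrow>
    B \<in> carrier H \<rightarrow> carrier H \<and>
    (\<forall>x\<in>carrier H. \<forall>y\<in>carrier H. B (x \<oplus>\<^bsub>H\<^esub> y) = B x \<oplus>\<^bsub>H\<^esub> B y) \<and>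
    (\<forall>c. \<forall>x\<in>carrier H. B (c \<odot>\<^bsub>H\<^esub> x) = c \<odot>\<^bsub>H\<^esub> B x) \<and>
    (\<exists>K. \<forall>x\<in>carrier H. hnorm H (B x) \<le> K * hnorm H x)"

definition linear_into :: "'b ip_space \<Rightarrow> 'a::complex_inner set \<Rightarrow> ('a \<Rightarrow> 'b) \<Rightarrow> bool"
  where "linear_into H D \<Gamma> \<longleftrightarrow>
    \<Gamma> \<in> D \<rightarrow> carrier H \<and>
    (\<forall>f\<in>D. \<forall>g\<in>D. \<Gamma> (f + g) = \<Gamma> f \<oplus>\<^bsub>H\<^esub> \<Gamma> g) \<and>
    (\<forall>c. \<forall>f\<in>D. \<Gamma> (c *\<^sub>C f) = c \<odot>\<^bsub>H\<^esub> \<Gamma> f)"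


section \<open>Boundary triplets and almost solvable extensions\<close>

definition boundary_triplet ::
    "'a::complex_inner operator \<Rightarrow> 'b ip_space \<Rightarrow> ('a \<Rightarrow> 'b) \<Rightarrow> ('a \<Rightarrow> 'b) \<Rightarrow> bool"
  where "boundary_triplet A H \<Gamma>0 \<Gamma>1 \<longleftrightarrow>
    hilbert_space H \<and>
    linear_into H (Domain (adjoint_op A)) \<Gamma>0 \<and> linear_into H (Domain (adjoint_op A)) \<Gamma>1 \<and>
    (\<forall>(f, f') \<in> adjoint_op A. \<forall>(g, g') \<in> adjoint_op A.
      cinner f' g - cinner f g' = ip H (\<Gamma>1 f) (\<Gamma>0 g) - ip H (\<Gamma>0 f) (\<Gamma>1 g)) \<and>
    (\<lambda>f. (\<Gamma>1 f, \<Gamma>0 f)) ` Domain (adjoint_op A) = carrier H \<times> carrier H"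

definition solves ::
    "'a::complex_inner operator \<Rightarrow> 'a operator \<Rightarrow> 'b ip_space \<Rightarrow> ('a \<Rightarrow> 'b) \<Rightarrow> ('a \<Rightarrow> 'b) \<Rightarrow> ('b \<Rightarrow> 'b) \<Rightarrow> bool"
  where "solves A T H \<Gamma>0 \<Gamma>1 B \<longleftrightarrow>
    boundary_triplet A H \<Gamma>0 \<Gamma>1 \<and> bounded_operator_on H B \<and>
    Domain T = {f \<in> Domain (adjoint_op A). \<Gamma>1 f = B (\<Gamma>0 f)}"

text \<open>The boundary space is an arbitrary Hilbert space whose elements are taken from the type \<open>'a\<close>
  of the ambient space; its operations are unrelated to those of \<open>'a\<close>. This is no restriction:
  \<open>\<Gamma>0\<close> maps a subset of \<open>'a\<close> onto the boundary space, so that any boundary space, over any type,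
  can be relabelled by elements of \<open>'a\<close>. Lemma \<open>almost_solvableI\<close> below proves this.\<close>

definition almost_solvable :: "'a::complex_inner operator \<Rightarrow> 'a operator \<Rightarrow> bool"
  where "almost_solvable A T \<longleftrightarrow> proper_extension A T \<and>
    (\<exists>(H :: 'a ip_space) \<Gamma>0 \<Gamma>1 B. solves A T H \<Gamma>0 \<Gamma>1 B)"

definition relabel :: "('b \<Rightarrow> 'c) \<Rightarrow> 'b ip_space \<Rightarrow> 'c ip_space"
  where "relabel i H = (let j = inv_into (carrier H) i in
    \<lparr>carrier = i ` carrier H, monoid.mult = undefined, one = undefined, zero = i \<zero>\<^bsub>H\<^esub>,
     add = (\<lambda>x y. i (j x \<oplus>\<^bsub>H\<^esub> j y)), module.smult = (\<lambda>c x. i (c \<odot>\<^bsub>H\<^esub> j x)), ip = (\<lambda>x y. ip H (j x) (j y))\<rparr>)"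

context
  fixes H :: "'b ip_space" and i :: "'b \<Rightarrow> 'c"
  assumes H: "hilbert_space H" and i: "inj_on i (carrier H)"
begin

interpretation hilbert_space H by (rule H)

lemma relabel_simps:
  "carrier (relabel i H) = i ` carrier H"
  "\<zero>\<^bsub>relabel i H\<^esub> = i \<zero>\<^bsub>H\<^esub>"
  "\<lbrakk>x \<in> carrier H; y \<in> carrier H\<rbrakk> \<Longrightarrow> i x \<oplus>\<^bsub>relabel i H\<^esub> i y = i (x \<oplus>\<^bsub>H\<^esub> y)"
  "x \<in> carrier H \<Longrightarrow> c \<odot>\<^bsub>relabel i H\<^esub> i x = i (c \<odot>\<^bsub>H\<^esub> x)"
  "\<lbrakk>x \<in> carrier H; y \<in> carrier H\<rbrakk> \<Longrightarrow> ip (relabel i H) (i x) (i y) = ip H x y"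
  "x \<in> carrier H \<Longrightarrow> hnorm (relabel i H) (i x) = hnorm H x"
  using i by (simp_all add: relabel_def Let_def hnorm_def)

lemma smult_closed': "x \<in> carrier H \<Longrightarrow> c \<odot>\<^bsub>H\<^esub> x \<in> carrier H"
  by (rule smult_closed) (simp_all add: ring_of_type_algebra_def)

lemma relabel_module: "Module.module (ring_of_type_algebra :: complex ring) (relabel i H)"
proof (rule moduleI)
  show "cring (ring_of_type_algebra :: complex ring)"
    by (rule R.cring_axioms)
  show "abelian_group (relabel i H)"
  proof (rule abelian_groupI)
    fix x assume "x \<in> carrier (relabel i H)"
    then obtain u where u: "u \<in> carrier H" "x = i u" by (auto simp: relabel_simps)
    then show "\<exists>y\<in>carrier (relabel i H). y \<oplus>\<^bsub>relabel i H\<^esub> x = \<zero>\<^bsub>relabel i H\<^esub>"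
      by (intro bexI[of _ "i (\<ominus>\<^bsub>H\<^esub> u)"]) (auto simp: relabel_simps M.l_neg)
  qed (auto simp: relabel_simps M.a_ac)
next
  fix c d :: complex and x y
  assume "x \<in> carrier (relabel i H)" "y \<in> carrier (relabel i H)"
  then obtain u v where u: "u \<in> carrier H" "x = i u" and v: "v \<in> carrier H" "y = i v"
    by (auto simp: relabel_simps)
  show "c \<odot>\<^bsub>relabel i H\<^esub> (x \<oplus>\<^bsub>relabel i H\<^esub> y) =
      c \<odot>\<^bsub>relabel i H\<^esub> x \<oplus>\<^bsub>relabel i H\<^esub> c \<odot>\<^bsub>relabel i H\<^esub> y"
    using u v smult_r_distr[of c u v]
    by (simp add: relabel_simps smult_closed' ring_of_type_algebra_def)
next
  fix c d :: complex and x
  assume "x \<in> carrier (relabel i H)"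
  then obtain u where u: "u \<in> carrier H" "x = i u"
    by (auto simp: relabel_simps)
  show "c \<odot>\<^bsub>relabel i H\<^esub> x \<in> carrier (relabel i H)"
    using u by (simp add: relabel_simps smult_closed')
  show "(c \<oplus>\<^bsub>ring_of_type_algebra\<^esub> d) \<odot>\<^bsub>relabel i H\<^esub> x =
      c \<odot>\<^bsub>relabel i H\<^esub> x \<oplus>\<^bsub>relabel i H\<^esub> d \<odot>\<^bsub>relabel i H\<^esub> x"
    using u smult_l_distr[of c d u]
    by (simp add: relabel_simps smult_closed' ring_of_type_algebra_def)
  show "(c \<otimes>\<^bsub>ring_of_type_algebra\<^esub> d) \<odot>\<^bsub>relabel i H\<^esub> x =
      c \<odot>\<^bsub>relabel i H\<^esub> (d \<odot>\<^bsub>relabel i H\<^esub> x)"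
    using u smult_assoc1[of c d u]
    by (simp add: relabel_simps smult_closed' ring_of_type_algebra_def)
  show "\<one>\<^bsub>ring_of_type_algebra\<^esub> \<odot>\<^bsub>relabel i H\<^esub> x = x"
    using u smult_one[of u] by (simp add: relabel_simps ring_of_type_algebra_def)
qed

lemma relabel_minus:
  assumes "x \<in> carrier H" "y \<in> carrier H"
  shows "i x \<ominus>\<^bsub>relabel i H\<^esub> i y = i (x \<ominus>\<^bsub>H\<^esub> y)"
proof -
  interpret N: Module.module "ring_of_type_algebra :: complex ring" "relabel i H"
    by (rule relabel_module)
  have "\<ominus>\<^bsub>relabel i H\<^esub> i y = i (\<ominus>\<^bsub>H\<^esub> y)"
    by (rule N.M.minus_equality) (use assms in \<open>auto simp: relabel_simps M.l_neg\<close>)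
  then show ?thesis
    using assms by (simp add: a_minus_def relabel_simps)
qed

lemma hilbert_space_relabel: "hilbert_space (relabel i H)"
proof -
  interpret N: Module.module "ring_of_type_algebra :: complex ring" "relabel i H"
    by (rule relabel_module)
  show ?thesis
  proof
    fix s :: "nat \<Rightarrow> 'c"
    assume s: "\<And>n. s n \<in> carrier (relabel i H)"
      and C: "\<And>e. 0 < e \<Longrightarrow> \<exists>N. \<forall>m\<ge>N. \<forall>n\<ge>N. hnorm (relabel i H) (s m \<ominus>\<^bsub>relabel i H\<^esub> s n) < e"
    have "\<forall>n. \<exists>u. u \<in> carrier H \<and> s n = i u"
      using s by (auto simp: relabel_simps)
    then obtain t where t: "\<And>n. t n \<in> carrier H" "\<And>n. s n = i (t n)" by metis
    have "\<exists>x\<in>carrier H. (\<lambda>n. hnorm H (t n \<ominus>\<^bsub>H\<^esub> x)) \<longlonglongrightarrow> 0"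
      by (rule complete) (use C t in \<open>simp_all add: relabel_minus relabel_simps\<close>)
    then show "\<exists>x\<in>carrier (relabel i H). (\<lambda>n. hnorm (relabel i H) (s n \<ominus>\<^bsub>relabel i H\<^esub> x)) \<longlonglongrightarrow> 0"
      using t by (auto simp: relabel_minus relabel_simps)
  next
    fix x y assume "x \<in> carrier (relabel i H)" "y \<in> carrier (relabel i H)"
    then obtain u v where "u \<in> carrier H" "x = i u" "v \<in> carrier H" "y = i v"
      by (auto simp: relabel_simps)
    then show "ip (relabel i H) x y = cnj (ip (relabel i H) y x)"
      using ip_commute[of u v] by (simp only: relabel_simps)
  qed (auto simp: relabel_simps ip_add_left ip_smult_left smult_closed' intro!: ip_pos)
qed

end

lemma almost_solvableI:
  fixes A T :: "'a::complex_inner operator" and H :: "'b ip_space"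
  assumes "proper_extension A T" and S: "solves A T H \<Gamma>0 \<Gamma>1 B"
  shows "almost_solvable A T"
proof -
  define D where "D = Domain (adjoint_op A)"
  define i where "i = inv_into D \<Gamma>0"
  define j where "j = inv_into (carrier H) i"
  have bt: "boundary_triplet A H \<Gamma>0 \<Gamma>1" and B: "bounded_operator_on H B"
    and dom: "Domain T = {f \<in> D. \<Gamma>1 f = B (\<Gamma>0 f)}"
    using S by (auto simp: solves_def D_def)
  then have H: "hilbert_space H" and l: "linear_into H D \<Gamma>0" "linear_into H D \<Gamma>1"
    and green: "\<And>f f' g g'. (f, f') \<in> adjoint_op A \<Longrightarrow> (g, g') \<in> adjoint_op A \<Longrightarrow>
      cinner f' g - cinner f g' = ip H (\<Gamma>1 f) (\<Gamma>0 g) - ip H (\<Gamma>0 f) (\<Gamma>1 g)"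
    and onto: "(\<lambda>f. (\<Gamma>1 f, \<Gamma>0 f)) ` D = carrier H \<times> carrier H"
    by (auto simp: boundary_triplet_def D_def)
  have cl: "\<Gamma>0 f \<in> carrier H" "\<Gamma>1 f \<in> carrier H" if "f \<in> D" for f
    using l that by (auto simp: linear_into_def)
  have "\<Gamma>0 ` D = snd ` ((\<lambda>f. (\<Gamma>1 f, \<Gamma>0 f)) ` D)"
    by (simp add: image_image)
  also have "\<dots> = carrier H"
    unfolding onto by auto
  finally have i: "inj_on i (carrier H)"
    unfolding i_def by (metis inj_on_inv_into order_refl)
  have j: "j (i x) = x" if "x \<in> carrier H" for x
    using that i by (simp add: j_def)
  have inD: "f \<in> D" if "(f, f') \<in> adjoint_op A" for f f'
    using that by (auto simp: D_def)
  note r = relabel_simps[OF H i]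
  have eq: "i x = i y \<longleftrightarrow> x = y" if "x \<in> carrier H" "y \<in> carrier H" for x y
    using i that by (auto simp: inj_on_def)
  have Bc: "B x \<in> carrier H" if "x \<in> carrier H" for x
    using B that by (auto simp: bounded_operator_on_def)
  have "boundary_triplet A (relabel i H) (i \<circ> \<Gamma>0) (i \<circ> \<Gamma>1)"
    unfolding boundary_triplet_def D_def[symmetric]
  proof (intro conjI)
    show "hilbert_space (relabel i H)"
      by (rule hilbert_space_relabel[OF H i])
    show "linear_into (relabel i H) D (i \<circ> \<Gamma>0)" "linear_into (relabel i H) D (i \<circ> \<Gamma>1)"
      using l cl by (simp_all add: linear_into_def r Pi_def)
    show "\<forall>(f, f') \<in> adjoint_op A. \<forall>(g, g') \<in> adjoint_op A. cinner f' g - cinner f g' =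
      ip (relabel i H) ((i \<circ> \<Gamma>1) f) ((i \<circ> \<Gamma>0) g) - ip (relabel i H) ((i \<circ> \<Gamma>0) f) ((i \<circ> \<Gamma>1) g)"
      using green inD cl by (auto simp: r)
    have "(\<lambda>f. ((i \<circ> \<Gamma>1) f, (i \<circ> \<Gamma>0) f)) ` D = map_prod i i ` ((\<lambda>f. (\<Gamma>1 f, \<Gamma>0 f)) ` D)"
      by (simp add: image_image)
    also have "\<dots> = carrier (relabel i H) \<times> carrier (relabel i H)"
      unfolding onto by (simp add: r map_prod_surj_on)
    finally show "(\<lambda>f. ((i \<circ> \<Gamma>1) f, (i \<circ> \<Gamma>0) f)) ` D = carrier (relabel i H) \<times> carrier (relabel i H)" .
  qed
  moreover have "bounded_operator_on (relabel i H) (i \<circ> B \<circ> j)"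
    using B hilbert_space.axioms(1)[OF H] Bc smult_closed'[OF H i]
      abelian_group.axioms(1)[OF Module.module.axioms(2)[OF hilbert_space.axioms(1)[OF H]]]
    by (auto simp: bounded_operator_on_def r j abelian_monoid.a_closed)
  moreover have "Domain T = {f \<in> D. (i \<circ> \<Gamma>1) f = (i \<circ> B \<circ> j) ((i \<circ> \<Gamma>0) f)}"
    using dom cl Bc j eq by auto
  ultimately have "solves A T (relabel i H) (i \<circ> \<Gamma>0) (i \<circ> \<Gamma>1) (i \<circ> B \<circ> j)"
    by (simp add: solves_def D_def)
  with assms(1) show ?thesis
    unfolding almost_solvable_def by blast
qed

end

theory Submission
  imports Defs
begin

text \<open>Let \<open>Im w < 0 < Im z\<close> with \<open>w\<close>, \<open>z\<close> in the resolvent set of \<open>T\<close>. By von Neumann's formula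
  \<open>A\<^sup>* / A\<close> is the sum of the defect spaces \<open>V\<close> at \<open>cnj w\<close> and \<open>W\<close> at \<open>w\<close>, on which the boundary form
  is positive and negative, respectively. Since \<open>w\<close> is in the resolvent set, \<open>T / A\<close> is the graph of a
  bounded operator \<open>S\<close> from \<open>V\<close> to \<open>W\<close>. The eigenspace of \<open>A\<^sup>*\<close> at \<open>z\<close> is maximal positive, hence the
  graph of an operator \<open>C\<close> with \<open>\<parallel>C\<parallel> < 1\<close>; since \<open>z\<close> is in the resolvent set, it is a complement of
  \<open>T / A\<close>, which means that \<open>S - C\<close> is bijective. Write \<open>S - C = U P\<close> with \<open>U\<close> unitary and \<open>P\<close> positive.
  Then \<open>1 + U\<^sup>* S = 1 + P + U\<^sup>* C\<close> has real part at least \<open>1 - \<parallel>C\<parallel>\<close> and is invertible, so the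
  self-adjoint extension given by the graph of \<open>- U\<close> is transversal to \<open>T\<close>; take it as the kernel
  of \<open>\<Gamma>0\<close>.\<close>

section \<open>Complex inner products\<close>

\<comment> \<open>Makes the bounded operators on such a space a complete metric space, as the fixed
  point argument for square roots requires.\<close>
subclass (in complex_hilbert) banach ..

lemma cinner_add_right: "cinner x (y + z) = cinner x y + cinner x z"
  by (metis cinner_add_left cinner_commute complex_cnj_add)

lemma cinner_scaleC_right: "cinner x (c *\<^sub>C y) = cnj c * cinner x y"
  by (metis cinner_commute cinner_scaleC_left complex_cnj_mult)

lemma Im_cinner: "Im (cinner x y) = inner x (\<i> *\<^sub>C y)"
  using Re_cinner[of x "\<i> *\<^sub>C y"] by (simp add: cinner_scaleC_right)

lemma cinner_eq: "cinner x y = complex_of_real (inner x y) + \<i> * complex_of_real (inner x (\<i> *\<^sub>C y))"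
  by (simp add: complex_eq_iff Re_cinner Im_cinner)

lemma cinner_minus_left: "cinner (- x) y = - cinner x y"
  using cinner_scaleC_left[of "-1" x y] by simp

lemma cinner_minus_right: "cinner x (- y) = - cinner x y"
  using cinner_scaleC_right[of x "-1" y] by simp

lemma cinner_diff_left: "cinner (x - y) z = cinner x z - cinner y z"
  using cinner_add_left[of x "-y" z] by (simp add: cinner_minus_left)

lemma cinner_diff_right: "cinner z (x - y) = cinner z x - cinner z y"
  using cinner_add_right[of z x "-y"] by (simp add: cinner_minus_right)

lemma cinner_zero_left [simp]: "cinner 0 x = 0"
  using cinner_scaleC_left[of 0 0 x] by simp

lemma cinner_zero_right [simp]: "cinner x 0 = 0"
  using cinner_scaleC_right[of x 0 0] by simp

lemma cinner_self: "cinner x x = complex_of_real ((norm x)\<^sup>2)"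
proof -
  have "Im (cinner x x) = 0"
    using cinner_commute[of x x] by (metis complex_cnj_cancel_iff complex_is_Real_iff Reals_cnj_iff)
  then show ?thesis
    by (simp add: complex_eq_iff Re_cinner power2_norm_eq_inner)
qed

lemma cinner_right_eqI: "(\<And>y. cinner x y = cinner x' y) \<Longrightarrow> x = x'"
  by (metis Re_cinner inner_eq_zero_iff inner_diff_left right_minus_eq)

lemmas cinner_simps = cinner_add_left cinner_add_right cinner_diff_left cinner_diff_right
  cinner_minus_left cinner_minus_right cinner_scaleC_left cinner_scaleC_right

lemmas scaleC_simps = scaleC_add_left scaleC_add_right scaleC_scaleC
  complex_vector.scale_left_diff_distrib complex_vector.scale_right_diff_distrib

lemma norm_scaleC: "norm (c *\<^sub>C x) = cmod c * norm x"
proof -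
  have "complex_of_real ((norm (c *\<^sub>C x))\<^sup>2) = c * cnj c * complex_of_real ((norm x)\<^sup>2)"
    unfolding cinner_self[symmetric] by (simp add: cinner_simps)
  also have "\<dots> = complex_of_real ((cmod c * norm x)\<^sup>2)"
    by (simp only: power_mult_distrib of_real_mult complex_norm_square)
  finally have "(norm (c *\<^sub>C x))\<^sup>2 = (cmod c * norm x)\<^sup>2"
    using of_real_eq_iff by blast
  then show ?thesis
    by (simp add: power2_eq_iff_nonneg)
qed

lemma norm_cinner_le: "cmod (cinner x y) \<le> norm x * norm y"
proof (cases "cinner x y = 0")
  case False
  \<comment> \<open>A unimodular factor that rotates the inner product to its modulus, which reduces
    the claim to the real Cauchy-Schwarz inequality.\<close>
  define c where "c = cnj (sgn (cinner x y))"
  have c: "cmod c = 1"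
    using False by (simp add: c_def norm_sgn)
  have "complex_of_real (cmod (cinner x y)) = c * cinner x y"
    using False by (simp add: c_def sgn_eq field_simps complex_norm_square[symmetric] flip: power2_eq_square of_real_power)
  then have "cmod (cinner x y) = Re (cinner (c *\<^sub>C x) y)"
    by (metis cinner_scaleC_left Re_complex_of_real)
  also have "\<dots> \<le> norm (c *\<^sub>C x) * norm y"
    by (simp add: Re_cinner norm_cauchy_schwarz)
  finally show ?thesis
    by (simp add: norm_scaleC c)
qed simp

lemma bounded_linear_scaleC: "bounded_linear (scaleC c :: 'a \<Rightarrow> 'a::complex_inner)"
proof (rule bounded_linear_intro)
  show "c *\<^sub>C r *\<^sub>R x = r *\<^sub>R c *\<^sub>C x" for r and x :: 'a
    by (simp add: scaleC_of_real[symmetric] scaleC_scaleC mult.commute)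
  show "norm (c *\<^sub>C x) \<le> norm x * cmod c" for x :: 'a
    by (simp add: norm_scaleC)
qed (simp add: scaleC_simps)

lemma continuous_on_scaleC [continuous_intros]:
  "continuous_on s f \<Longrightarrow> continuous_on s (\<lambda>x. c *\<^sub>C (f x :: 'a::complex_inner))"
  by (rule bounded_linear.continuous_on[OF bounded_linear_scaleC])

lemma continuous_on_cinner [continuous_intros]:
  "continuous_on s f \<Longrightarrow> continuous_on s g \<Longrightarrow>
    continuous_on s (\<lambda>x. cinner (f x :: 'a::complex_inner) (g x))"
  unfolding cinner_eq by (intro continuous_intros)

lemma complex_subspace_imp_subspace: "complex_vector.subspace V \<Longrightarrow> subspace V"
  by (simp add: subspace_def complex_vector.subspace_def scaleC_of_real[symmetric])

section \<open>Projections, Riesz representation and square roots\<close>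

text \<open>A minimising sequence for the distance is Cauchy by the parallelogram law, since the
  midpoint of two of its terms lies in \<open>V\<close>. Minimality of its limit then gives
  orthogonality.\<close>

lemma projection_exists:
  fixes V :: "'a::{real_inner, complete_space} set"
  assumes V: "subspace V" "closed V"
  shows "\<exists>y\<in>V. \<forall>v\<in>V. inner (x - y) v = 0"
proof -
  define d where "d = (INF v\<in>V. (norm (x - v))\<^sup>2)"
  have ne: "V \<noteq> {}"
    using V(1) subspace_0 by auto
  have bdd: "bdd_below ((\<lambda>v. (norm (x - v))\<^sup>2) ` V)"
    by (rule bdd_belowI[of _ 0]) auto
  have d: "d \<le> (norm (x - v))\<^sup>2" if "v \<in> V" for v
    unfolding d_def by (rule cINF_lower[OF bdd that])
  have "\<exists>v\<in>V. (norm (x - v))\<^sup>2 < d + inverse (real (Suc n))" for n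
    using cINF_less_iff[OF ne bdd, of "d + inverse (real (Suc n))"] by (auto simp: d_def)
  then obtain y where y: "\<And>n. y n \<in> V" "\<And>n. (norm (x - y n))\<^sup>2 < d + inverse (real (Suc n))"
    by metis
  have par: "(norm (y m - y n))\<^sup>2 \<le> 2 * inverse (real (Suc m)) + 2 * inverse (real (Suc n))" for m n
  proof -
    have "(1/2) *\<^sub>R (y m + y n) \<in> V"
      using V(1) y(1) by (simp add: subspace_add subspace_scale)
    from d[OF this] have "4 * d \<le> 4 * (norm (x - (1/2) *\<^sub>R (y m + y n)))\<^sup>2"
      by simp
    also have "\<dots> = 2 * (norm (x - y m))\<^sup>2 + 2 * (norm (x - y n))\<^sup>2 - (norm (y m - y n))\<^sup>2"
      by (simp add: power2_norm_eq_inner inner_simps inner_commute field_simps)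
    finally show ?thesis
      using y(2)[of m] y(2)[of n] by simp
  qed
  have "Cauchy y"
  proof (rule metric_CauchyI)
    fix e :: real assume "0 < e"
    then obtain N where N: "inverse (real (Suc N)) < e\<^sup>2 / 4"
      using reals_Archimedean[of "e\<^sup>2 / 4"] by auto
    show "\<exists>M. \<forall>m\<ge>M. \<forall>n\<ge>M. dist (y m) (y n) < e"
    proof (intro exI[of _ N] allI impI)
      fix m n assume "N \<le> m" "N \<le> n"
      then have "inverse (real (Suc m)) \<le> inverse (real (Suc N))" "inverse (real (Suc n)) \<le> inverse (real (Suc N))"
        by (simp_all add: le_imp_inverse_le)
      then have "(norm (y m - y n))\<^sup>2 < e\<^sup>2"
        using par[of m n] N by linarith
      then show "dist (y m) (y n) < e"
        using \<open>0 < e\<close> by (simp add: dist_norm power2_less_imp_less)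
    qed
  qed
  then obtain l where l: "y \<longlonglongrightarrow> l"
    by (auto simp: Cauchy_convergent_iff convergent_def)
  have lV: "l \<in> V"
    using V(2) y(1) l by (auto simp: closed_sequential_limits)
  have "(norm (x - l))\<^sup>2 \<le> d"
  proof (rule LIMSEQ_le)
    show "(\<lambda>n. (norm (x - y n))\<^sup>2) \<longlonglongrightarrow> (norm (x - l))\<^sup>2"
      by (intro tendsto_intros l)
    show "(\<lambda>n. d + inverse (real (Suc n))) \<longlonglongrightarrow> d"
      using tendsto_add[OF tendsto_const LIMSEQ_inverse_real_of_nat, of d] by simp
    show "\<exists>N. \<forall>n\<ge>N. (norm (x - y n))\<^sup>2 \<le> d + inverse (real (Suc n))"
      using y(2) less_imp_le by blast
  qed
  have "inner (x - l) v = 0" if v: "v \<in> V" for v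
  proof (cases "v = 0")
    case False
    \<comment> \<open>The value of \<open>t\<close> that minimises
      \<open>norm ((x - l) - t *\<^sub>R v)\<close>.\<close>
    define t where "t = inner (x - l) v / (norm v)\<^sup>2"
    have "l + t *\<^sub>R v \<in> V"
      using V(1) lV v by (simp add: subspace_add subspace_scale)
    from d[OF this] have "(norm (x - l))\<^sup>2 \<le> (norm ((x - l) - t *\<^sub>R v))\<^sup>2"
      using \<open>(norm (x - l))\<^sup>2 \<le> d\<close> unfolding diff_diff_eq by linarith
    also have "\<dots> = (norm (x - l))\<^sup>2 - 2 * t * inner (x - l) v + t\<^sup>2 * (norm v)\<^sup>2"
      by (simp add: power2_norm_eq_inner inner_simps inner_commute algebra_simps power2_eq_square[of t])
    also have "t\<^sup>2 * (norm v)\<^sup>2 = t * inner (x - l) v"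
      using False by (simp add: t_def power2_eq_square)
    finally have "t * inner (x - l) v \<le> 0"
      by simp
    then have "(inner (x - l) v)\<^sup>2 / (norm v)\<^sup>2 \<le> 0"
      by (simp add: t_def power2_eq_square)
    then show ?thesis
      using False by (simp add: divide_le_0_iff)
  qed simp
  with lV show ?thesis by blast
qed

text \<open>The orthogonal complement of the kernel of a nonzero functional is a line, and a
  suitable multiple of a vector \<open>z\<close> spanning it represents the functional.\<close>

lemma riesz_representation:
  fixes \<phi> :: "'a::{real_inner, complete_space} \<Rightarrow> real"
  assumes "bounded_linear \<phi>"
  shows "\<exists>a. \<forall>y. \<phi> y = inner a y"
proof (cases "\<forall>y. \<phi> y = 0")
  case True
  then show ?thesis by (intro exI[of _ 0]) simp
next
  case False
  interpret \<phi>: bounded_linear \<phi> by fact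
  let ?V = "{y. \<phi> y = 0}"
  obtain x where x: "\<phi> x \<noteq> 0" using False by auto
  have "closed ?V"
    by (intro closed_Collect_eq continuous_intros \<phi>.continuous_on)
  moreover have "subspace ?V"
    by (auto simp: subspace_def \<phi>.add \<phi>.scaleR \<phi>.zero)
  ultimately obtain y where y: "\<phi> y = 0" "\<And>v. \<phi> v = 0 \<Longrightarrow> inner (x - y) v = 0"
    using projection_exists[of ?V x] by auto
  define z where "z = x - y"
  have z: "\<phi> z \<noteq> 0" "z \<noteq> 0"
    using x y by (auto simp: z_def \<phi>.diff)
  have "\<phi> v = inner ((\<phi> z / inner z z) *\<^sub>R z) v" for v
  proof -
    have "\<phi> (v - (\<phi> v / \<phi> z) *\<^sub>R z) = 0"
      using z by (simp add: \<phi>.diff \<phi>.scaleR)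
    from y(2)[OF this] have "inner z v = \<phi> v / \<phi> z * inner z z"
      by (simp add: z_def[symmetric] inner_diff_right)
    then show ?thesis
      using z by simp
  qed
  then show ?thesis by blast
qed

text \<open>\<open>M x\<close> is the Riesz vector of the functional \<open>b x\<close>; testing
  with \<open>y = M x\<close> bounds its norm.\<close>

lemma bounded_bilinear_form_representation:
  fixes b :: "'a::{real_inner, complete_space} \<Rightarrow> 'a \<Rightarrow> real"
  assumes "bounded_bilinear b"
  shows "\<exists>M. bounded_linear M \<and> (\<forall>x y. inner (M x) y = b x y)"
proof -
  interpret b: bounded_bilinear b by fact
  have "\<forall>x. \<exists>a. \<forall>y. b x y = inner a y"
    using riesz_representation b.bounded_linear_right by blast
  then obtain M where M: "\<And>x y. b x y = inner (M x) y" by metis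
  obtain K where K: "0 < K" "\<And>x y. norm (b x y) \<le> norm x * norm y * K"
    using b.pos_bounded by blast
  have "bounded_linear M"
  proof (rule bounded_linear_intro)
    fix x y :: 'a and r :: real
    show "M (x + y) = M x + M y"
      by (rule vector_eq_rdot[THEN iffD1]) (auto simp: inner_simps M[symmetric] b.add_left)
    show "M (r *\<^sub>R x) = r *\<^sub>R M x"
      by (rule vector_eq_rdot[THEN iffD1]) (auto simp: inner_simps M[symmetric] b.scaleR_left)
    have "norm (M x) * norm (M x) \<le> (norm x * K) * norm (M x)"
      using K(2)[of x "M x"] by (simp add: M power2_norm_eq_inner[symmetric] power2_eq_square algebra_simps)
    then show "norm (M x) \<le> norm x * K"
      using K(1) by (cases "M x = 0") auto
  qed
  then show ?thesis using M by auto
qed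

section \<open>Coercive operators: Lax-Milgram and square roots\<close>

text \<open>Expanding the square bounds \<open>(norm (x - t *\<^sub>R y))\<^sup>2\<close> by a
  quadratic in \<open>t\<close> times \<open>(norm x)\<^sup>2\<close>; the chosen \<open>t\<close>
  minimises the quadratic. The form with vectors \<open>x\<close>, \<open>y\<close> in place of an
  operator serves both maps on a subspace and bounded operators on the whole space.\<close>

lemma contraction_factor_exists:
  fixes c K :: real
  assumes "0 < c"
  shows "\<exists>t>0. \<exists>\<gamma>. 0 \<le> \<gamma> \<and> \<gamma> < 1 \<and> (\<forall>x y :: 'a::real_inner.
    c * (norm x)\<^sup>2 \<le> inner y x \<longrightarrow> norm y \<le> K * norm x \<longrightarrow> norm (x - t *\<^sub>R y) \<le> \<gamma> * norm x)"
proof -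
  \<comment> \<open>Enlarging the bound \<open>K\<close> to \<open>k\<close> ensures
    \<open>0 < k\<close> and \<open>c \<le> k\<close>, so that the number under the root in
    \<open>\<gamma>\<close> is not negative.\<close>
  define k where "k = \<bar>K\<bar> + c"
  have k: "0 < k" "c \<le> k" "K \<le> k" using assms by (auto simp: k_def)
  define t where "t = c / k\<^sup>2"
  have "0 < t" using assms k by (simp add: t_def)
  have tk: "2 * t * c - t\<^sup>2 * k\<^sup>2 = c\<^sup>2 / k\<^sup>2"
    using k(1) by (simp add: t_def power2_eq_square)
  define \<gamma> where "\<gamma> = sqrt (1 - c\<^sup>2 / k\<^sup>2)"
  have "c\<^sup>2 \<le> k\<^sup>2"
    using k assms by (intro power_mono) auto
  then have q: "0 < c\<^sup>2 / k\<^sup>2" "c\<^sup>2 / k\<^sup>2 \<le> 1"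
    using k assms by simp_all
  then have \<gamma>: "0 \<le> \<gamma>" "\<gamma> < 1" "\<gamma>\<^sup>2 = 1 - c\<^sup>2 / k\<^sup>2"
    by (auto simp: \<gamma>_def)
  have "norm (x - t *\<^sub>R y) \<le> \<gamma> * norm x"
    if c: "c * (norm x)\<^sup>2 \<le> inner y x" and K: "norm y \<le> K * norm x" for x y :: 'a
  proof -
    have "norm y \<le> k * norm x"
      using K mult_right_mono[OF k(3) norm_ge_zero[of x]] by linarith
    from power_mono[OF this norm_ge_zero, of 2]
    have y: "(norm y)\<^sup>2 \<le> k\<^sup>2 * (norm x)\<^sup>2"
      by (simp add: power_mult_distrib)
    have "(norm (x - t *\<^sub>R y))\<^sup>2 = (norm x)\<^sup>2 - 2 * t * inner y x + t\<^sup>2 * (norm y)\<^sup>2"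
      by (simp add: power2_norm_eq_inner inner_simps inner_commute algebra_simps power2_eq_square[of t])
    also have "\<dots> \<le> (norm x)\<^sup>2 - 2 * t * (c * (norm x)\<^sup>2) + t\<^sup>2 * (k\<^sup>2 * (norm x)\<^sup>2)"
    proof (intro add_mono diff_mono order_refl)
      show "2 * t * (c * (norm x)\<^sup>2) \<le> 2 * t * inner y x"
        using \<open>0 < t\<close> by (intro mult_left_mono[OF c]) simp
      show "t\<^sup>2 * (norm y)\<^sup>2 \<le> t\<^sup>2 * (k\<^sup>2 * (norm x)\<^sup>2)"
        by (intro mult_left_mono[OF y]) simp
    qed
    also have "\<dots> = (1 - (2 * t * c - t\<^sup>2 * k\<^sup>2)) * (norm x)\<^sup>2"
      by (simp add: algebra_simps)
    also have "\<dots> = (\<gamma> * norm x)\<^sup>2"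
      unfolding power_mult_distrib \<gamma>(3) tk ..
    finally show ?thesis
      by (rule power2_le_imp_le) (simp add: \<gamma>(1))
  qed
  then show ?thesis
    using \<gamma>(1,2) \<open>0 < t\<close> by (intro exI[of _ t] exI[of _ \<gamma>] conjI allI impI)
qed

text \<open>The contraction \<open>x \<mapsto> x - t (G x - y)\<close> has a solution of \<open>G x = y\<close> as its fixed point.\<close>

lemma lax_milgram:
  fixes G :: "'a::{real_inner, complete_space} \<Rightarrow> 'a"
  assumes V: "subspace V" "closed V"
    and G: "\<And>x. x \<in> V \<Longrightarrow> G x \<in> V"
      "\<And>x y. x \<in> V \<Longrightarrow> y \<in> V \<Longrightarrow> G (x - y) = G x - G y"
      "\<And>x. x \<in> V \<Longrightarrow> norm (G x) \<le> K * norm x"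
      "\<And>x. x \<in> V \<Longrightarrow> c * (norm x)\<^sup>2 \<le> inner (G x) x"
    and "0 < c" "y \<in> V"
  shows "\<exists>x\<in>V. G x = y"
proof -
  obtain t \<gamma> where t: "0 < t" "0 \<le> \<gamma>" "\<gamma> < 1"
    and contr: "\<And>x y :: 'a. c * (norm x)\<^sup>2 \<le> inner y x \<Longrightarrow> norm y \<le> K * norm x \<Longrightarrow>
      norm (x - t *\<^sub>R y) \<le> \<gamma> * norm x"
    using contraction_factor_exists[OF \<open>0 < c\<close>, of K] by metis
  have "\<exists>!x\<in>V. x - t *\<^sub>R (G x - y) = x"
  proof (rule Banach_fix)
    show "complete V" using V(2) by (simp add: complete_eq_closed)
    show "V \<noteq> {}" using V(1) subspace_0 by auto
    show "(\<lambda>x. x - t *\<^sub>R (G x - y)) ` V \<subseteq> V"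
      using V(1) G(1) \<open>y \<in> V\<close> by (auto intro!: subspace_diff subspace_scale)
    fix x z assume x: "x \<in> V" "z \<in> V"
    then have d: "x - z \<in> V" using V(1) subspace_diff by blast
    have "dist (x - t *\<^sub>R (G x - y)) (z - t *\<^sub>R (G z - y)) = norm ((x - z) - t *\<^sub>R G (x - z))"
      using x by (simp add: dist_norm G(2) algebra_simps)
    also have "\<dots> \<le> \<gamma> * norm (x - z)"
      using contr G(3,4)[OF d] by blast
    finally show "dist (x - t *\<^sub>R (G x - y)) (z - t *\<^sub>R (G z - y)) \<le> \<gamma> * dist x z"
      by (simp add: dist_norm)
  qed (use t in auto)
  then show ?thesis using t(1) by auto
qed

text \<open>If \<open>Y\<close> is a fixed point of \<open>Y \<mapsto> (1 - t M + Y\<^sup>2) / 2\<close>, then \<open>(1 - Y)\<^sup>2 = t M\<close>.\<close>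

lemma positive_square_root_exists:
  fixes M :: "'a::complex_hilbert \<Rightarrow>\<^sub>L 'a"
  assumes c: "0 < c" "\<And>x. c * (norm x)\<^sup>2 \<le> inner (M x) x"
    and sa: "\<And>x y. cinner (M x) y = cinner x (M y)"
    and V: "subspace V" "closed V" "\<And>x. x \<in> V \<Longrightarrow> M x \<in> V"
  shows "\<exists>P :: 'a \<Rightarrow>\<^sub>L 'a. \<exists>d>0. (\<forall>x. P (P x) = M x) \<and> (\<forall>x. d * (norm x)\<^sup>2 \<le> inner (P x) x) \<and>
    (\<forall>x y. cinner (P x) y = cinner x (P y)) \<and> (\<forall>x\<in>V. P x \<in> V)"
proof -
  obtain t \<gamma> where t: "0 < t" "0 \<le> \<gamma>" "\<gamma> < 1"
    and contr: "\<And>x y :: 'a. c * (norm x)\<^sup>2 \<le> inner y x \<Longrightarrow> norm y \<le> norm M * norm x \<Longrightarrow>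
      norm (x - t *\<^sub>R y) \<le> \<gamma> * norm x"
    using contraction_factor_exists[OF c(1), of "norm M"] by metis
  define E where "E = id_blinfun - t *\<^sub>R M"
  have E: "blinfun_apply E x = x - t *\<^sub>R M x" for x
    by (simp add: E_def blinfun.bilinear_simps)
  have "norm E \<le> \<gamma>"
    by (rule norm_blinfun_bound[OF t(2)]) (simp add: E contr c(2) norm_blinfun)
  \<comment> \<open>The smaller root of \<open>r^2 - 2 r + \<gamma> = 0\<close>: the fixed point map
    sends the ball of radius \<open>r\<close> into itself and has Lipschitz constant
    \<open>r < 1\<close> there.\<close>
  define r where "r = 1 - sqrt (1 - \<gamma>)"
  have r: "0 \<le> r" "r < 1" using t by (auto simp: r_def)
  have "r\<^sup>2 = 1 - 2 * sqrt (1 - \<gamma>) + (sqrt (1 - \<gamma>))\<^sup>2"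
    unfolding r_def power2_eq_square by (simp add: algebra_simps)
  also have "(sqrt (1 - \<gamma>))\<^sup>2 = 1 - \<gamma>"
    using t(3) by simp
  finally have r2: "\<gamma> + r\<^sup>2 = 2 * r"
    by (simp add: r_def)
  \<comment> \<open>Self-adjointness and invariance of \<open>V\<close> are closed conditions
    preserved by the iteration; as part of \<open>\<Omega>\<close> they pass to the fixed
    point.\<close>
  define \<Omega> where "\<Omega> = {Y :: 'a \<Rightarrow>\<^sub>L 'a. norm Y \<le> r \<and>
    (\<forall>x y. cinner (blinfun_apply Y x) y = cinner x (blinfun_apply Y y)) \<and> (\<forall>x\<in>V. blinfun_apply Y x \<in> V)}"
  define \<Phi> where "\<Phi> = (\<lambda>Y :: 'a \<Rightarrow>\<^sub>L 'a. (1/2) *\<^sub>R (E + (Y o\<^sub>L Y)))"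
  have \<Phi>: "blinfun_apply (\<Phi> Y) x = (1/2) *\<^sub>R (x - t *\<^sub>R M x + Y (Y x))" for Y x
    by (simp add: \<Phi>_def blinfun.bilinear_simps E)
  have "\<exists>!Y\<in>\<Omega>. \<Phi> Y = Y"
  proof (rule Banach_fix[OF _ _ r])
    have cont: "continuous_on UNIV (\<lambda>Y :: 'a \<Rightarrow>\<^sub>L 'a. Y x)" for x
      by (intro continuous_intros)
    have "closed {Y :: 'a \<Rightarrow>\<^sub>L 'a. Y x \<in> V}" for x
      using continuous_closed_vimage[OF V(2), of "\<lambda>Y :: 'a \<Rightarrow>\<^sub>L 'a. Y x"] cont
      by (auto simp: vimage_def continuous_on_eq_continuous_at)
    then have "closed \<Omega>"
      unfolding \<Omega>_def Ball_def
      by (intro closed_Collect_conj closed_Collect_all closed_Collect_imp open_Collect_const closed_Collect_le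
          closed_Collect_eq continuous_intros)
    then show "complete \<Omega>" by (simp add: complete_eq_closed)
    have "0 \<in> \<Omega>"
      using r V(1) by (simp add: \<Omega>_def subspace_0)
    then show "\<Omega> \<noteq> {}" by auto
    show "\<Phi> ` \<Omega> \<subseteq> \<Omega>"
    proof (rule image_subsetI)
      fix Y assume Y: "Y \<in> \<Omega>"
      have "norm (Y o\<^sub>L Y) \<le> r * r"
        using Y by (intro order_trans[OF norm_blinfun_compose] mult_mono) (auto simp: \<Omega>_def r)
      then have "norm (E + (Y o\<^sub>L Y)) \<le> 2 * r"
        using \<open>norm E \<le> \<gamma>\<close> norm_triangle_ineq[of E "Y o\<^sub>L Y"] r2 by (simp add: power2_eq_square)
      then have "norm (\<Phi> Y) \<le> r" by (simp add: \<Phi>_def)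
      moreover have "cinner (\<Phi> Y x) y = cinner x (\<Phi> Y y)" for x y
        using Y by (simp add: \<Phi> \<Omega>_def cinner_simps sa flip: scaleC_of_real)
      moreover have "\<Phi> Y x \<in> V" if "x \<in> V" for x
        unfolding \<Phi> using Y V that by (intro subspace_scale subspace_add subspace_diff) (auto simp: \<Omega>_def)
      ultimately show "\<Phi> Y \<in> \<Omega>" by (simp add: \<Omega>_def)
    qed
    fix Y Z assume "Y \<in> \<Omega>" "Z \<in> \<Omega>"
    then have YZ: "norm Y \<le> r" "norm Z \<le> r" by (auto simp: \<Omega>_def)
    \<comment> \<open>\<open>Y\<close> and \<open>Z\<close> need not commute, hence this form of the
      difference of squares.\<close>
    have "\<Phi> Y - \<Phi> Z = (1/2) *\<^sub>R ((Y o\<^sub>L (Y - Z)) + ((Y - Z) o\<^sub>L Z))"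
      by (rule blinfun_eqI) (simp add: \<Phi> blinfun.bilinear_simps algebra_simps)
    also have "norm \<dots> \<le> (1/2) * (r * norm (Y - Z) + norm (Y - Z) * r)"
      unfolding norm_scaleR using YZ r
      by (intro mult_mono norm_triangle_le add_mono order_trans[OF norm_blinfun_compose]) auto
    finally show "dist (\<Phi> Y) (\<Phi> Z) \<le> r * dist Y Z"
      by (simp add: dist_norm mult.commute)
  qed
  then obtain Y where Y: "Y \<in> \<Omega>" "\<Phi> Y = Y" by blast
  have fix_Y: "2 *\<^sub>R Y x = x - t *\<^sub>R M x + Y (Y x)" for x
  proof -
    have "2 *\<^sub>R Y x = 2 *\<^sub>R (\<Phi> Y) x" by (simp add: Y(2))
    then show ?thesis by (simp add: \<Phi>)
  qed
  define P where "P = (1 / sqrt t) *\<^sub>R (id_blinfun - Y)"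
  have P: "blinfun_apply P x = (1 / sqrt t) *\<^sub>R (x - Y x)" for x
    by (simp add: P_def blinfun.bilinear_simps)
  have "P (P x) = M x" for x
  proof -
    have "P (P x) = (1 / t) *\<^sub>R (x - 2 *\<^sub>R Y x + Y (Y x))"
      using t(1) by (simp add: P blinfun.bilinear_simps algebra_simps scaleR_2)
    also have "x - 2 *\<^sub>R Y x + Y (Y x) = t *\<^sub>R M x"
      using fix_Y[of x] by (simp add: algebra_simps)
    finally have "P (P x) = (1 / t) *\<^sub>R (t *\<^sub>R M x)" .
    then show ?thesis using t(1) by simp
  qed
  moreover have "(1 - r) / sqrt t * (norm x)\<^sup>2 \<le> inner (P x) x" for x
  proof -
    have "norm (Y x) \<le> r * norm x"
      using Y(1) by (intro order_trans[OF norm_blinfun] mult_right_mono) (auto simp: \<Omega>_def)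
    then have "inner (Y x) x \<le> r * norm x * norm x"
      by (meson mult_right_mono norm_cauchy_schwarz norm_ge_zero order_trans)
    then have "(1 - r) * (norm x)\<^sup>2 \<le> inner (x - Y x) x"
      by (simp add: inner_simps power2_norm_eq_inner[symmetric] power2_eq_square algebra_simps)
    then have "(1 / sqrt t) * ((1 - r) * (norm x)\<^sup>2) \<le> (1 / sqrt t) * inner (x - Y x) x"
      using t(1) by (intro mult_left_mono) auto
    then show ?thesis
      by (simp add: P)
  qed
  moreover have "cinner (P x) y = cinner x (P y)" for x y
    using Y(1) by (simp add: P \<Omega>_def cinner_simps flip: scaleC_of_real)
  moreover have "P x \<in> V" if "x \<in> V" for x
    unfolding P using Y(1) V that by (intro subspace_scale subspace_diff) (auto simp: \<Omega>_def)
  ultimately show ?thesis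
    using t r by (intro exI[of _ P] exI[of _ "(1 - r) / sqrt t"]) auto
qed

section \<open>Polar decomposition between closed subspaces\<close>

definition closed_csubspace :: "'a::complex_inner set \<Rightarrow> bool"
  where "closed_csubspace V \<longleftrightarrow> complex_vector.subspace V \<and> closed V"

text \<open>Linearity is confined to \<open>V\<close> because several maps below, such as inverses
  obtained by choice, are controlled only there.\<close>

definition clinear_on :: "'a::complex_inner set \<Rightarrow> ('a \<Rightarrow> 'b::complex_inner) \<Rightarrow> bool"
  where "clinear_on V L \<longleftrightarrow>
    (\<forall>x\<in>V. \<forall>y\<in>V. L (x + y) = L x + L y) \<and> (\<forall>c. \<forall>x\<in>V. L (c *\<^sub>C x) = c *\<^sub>C L x)"

lemma clinear_onI:
  "(\<And>x y. x \<in> V \<Longrightarrow> y \<in> V \<Longrightarrow> L (x + y) = L x + L y) \<Longrightarrow>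
    (\<And>c x. x \<in> V \<Longrightarrow> L (c *\<^sub>C x) = c *\<^sub>C L x) \<Longrightarrow> clinear_on V L"
  by (simp add: clinear_on_def)

lemma clinear_on_add: "clinear_on V L \<Longrightarrow> x \<in> V \<Longrightarrow> y \<in> V \<Longrightarrow> L (x + y) = L x + L y"
  by (simp add: clinear_on_def)

lemma clinear_on_scaleC: "clinear_on V L \<Longrightarrow> x \<in> V \<Longrightarrow> L (c *\<^sub>C x) = c *\<^sub>C L x"
  by (simp add: clinear_on_def)

lemma clinear_on_diff:
  assumes "clinear_on V L" "complex_vector.subspace V" "x \<in> V" "y \<in> V"
  shows "L (x - y) = L x - L y"
proof -
  have "L (x + (-1) *\<^sub>C y) = L x + (-1) *\<^sub>C L y"
    using assms by (simp only: clinear_on_add clinear_on_scaleC complex_vector.subspace_scale)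
  then show ?thesis by simp
qed

lemma csubspace_simps:
  assumes "closed_csubspace V"
  shows "0 \<in> V" "x \<in> V \<Longrightarrow> y \<in> V \<Longrightarrow> x + y \<in> V" "x \<in> V \<Longrightarrow> y \<in> V \<Longrightarrow> x - y \<in> V"
    "x \<in> V \<Longrightarrow> c *\<^sub>C x \<in> V" "x \<in> V \<Longrightarrow> - x \<in> V"
  using assms by (auto simp: closed_csubspace_def complex_vector.subspace_0 complex_vector.subspace_add
      complex_vector.subspace_diff complex_vector.subspace_scale complex_vector.subspace_neg)

section \<open>Orthogonal projections onto closed complex subspaces\<close>

definition proj :: "'a::complex_inner set \<Rightarrow> 'a \<Rightarrow> 'a"
  where "proj V x = (SOME y. y \<in> V \<and> (\<forall>v\<in>V. cinner (x - y) v = 0))"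

context
  fixes V :: "'a::complex_hilbert set"
  assumes V: "closed_csubspace V"
begin

lemma proj_mem: "proj V x \<in> V"
  and proj_orth: "v \<in> V \<Longrightarrow> cinner (x - proj V x) v = 0"
proof -
  obtain y where y: "y \<in> V" "\<And>v. v \<in> V \<Longrightarrow> inner (x - y) v = 0"
    using projection_exists[of V x] V complex_subspace_imp_subspace by (auto simp: closed_csubspace_def)
  \<comment> \<open>Since \<open>V\<close> is invariant under \<i>, real orthogonality to
    \<open>V\<close> implies complex orthogonality.\<close>
  then have "y \<in> V \<and> (\<forall>v\<in>V. cinner (x - y) v = 0)"
    using csubspace_simps(4)[OF V] by (simp add: cinner_eq)
  then have "proj V x \<in> V \<and> (\<forall>v\<in>V. cinner (x - proj V x) v = 0)"
    unfolding proj_def by (rule someI)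
  then show "proj V x \<in> V" "v \<in> V \<Longrightarrow> cinner (x - proj V x) v = 0" by auto
qed

text \<open>Two candidates for the projection differ by a vector of \<open>V\<close> orthogonal to
  \<open>V\<close>. The algebraic rules for \<open>proj\<close> follow from this uniqueness.\<close>

lemma proj_eqI:
  assumes "y \<in> V" "\<And>v. v \<in> V \<Longrightarrow> cinner (x - y) v = 0"
  shows "proj V x = y"
proof -
  have d: "proj V x - y \<in> V"
    using proj_mem assms(1) csubspace_simps(3)[OF V] by blast
  have "cinner (proj V x - y) (proj V x - y) = cinner (x - y) (proj V x - y) - cinner (x - proj V x) (proj V x - y)"
    by (simp add: cinner_diff_left)
  also have "\<dots> = 0" using assms(2) proj_orth d by simp
  finally show ?thesis by (simp add: cinner_self)
qed

lemma proj_id: "x \<in> V \<Longrightarrow> proj V x = x"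
  by (rule proj_eqI) auto

lemma proj_eq_0: "(\<And>v. v \<in> V \<Longrightarrow> cinner x v = 0) \<Longrightarrow> proj V x = 0"
  by (rule proj_eqI) (auto simp: csubspace_simps[OF V])

lemma proj_add: "proj V (x + y) = proj V x + proj V y"
  using proj_orth[of _ x] proj_orth[of _ y]
  by (intro proj_eqI) (auto simp: csubspace_simps[OF V] proj_mem cinner_simps)

lemma proj_scaleC: "proj V (c *\<^sub>C x) = c *\<^sub>C proj V x"
  using proj_orth[of _ x]
  by (intro proj_eqI) (auto simp: csubspace_simps[OF V] proj_mem cinner_simps)

lemma cinner_proj_left: "v \<in> V \<Longrightarrow> cinner (proj V x) v = cinner x v"
  using proj_orth[of v x] by (simp add: cinner_diff_left)

lemma proj_pythagoras: "(norm x)\<^sup>2 = (norm (proj V x))\<^sup>2 + (norm (x - proj V x))\<^sup>2"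
proof -
  have "inner (x - proj V x) (proj V x) = 0"
    using proj_orth[OF proj_mem, of x x] by (simp flip: Re_cinner)
  then show ?thesis
    by (simp add: power2_norm_eq_inner inner_simps inner_commute)
qed

lemma norm_proj_le: "norm (proj V x) \<le> norm x"
  by (rule power2_le_imp_le) (simp_all add: proj_pythagoras[of x])

lemma bounded_linear_proj: "bounded_linear (proj V)"
  by (rule bounded_linear_intro[of _ 1])
    (auto simp: proj_add proj_scaleC norm_proj_le simp flip: scaleC_of_real)

end

text \<open>\<open>M\<close> is the product of the adjoint of \<open>F\<close> with
  \<open>F\<close>, obtained without constructing the adjoint: it represents the form
  \<open>inner (F x) (F y)\<close>, and compatibility of \<open>F\<close> with \<i> makes the
  representation complex.\<close>

lemma adjoint_product_exists:
  fixes F :: "'a::complex_hilbert \<Rightarrow> 'b::complex_inner"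
  assumes "bounded_linear F" and F: "\<And>x. F (\<i> *\<^sub>C x) = \<i> *\<^sub>C F x"
  shows "\<exists>M :: 'a \<Rightarrow>\<^sub>L 'a. \<forall>x y. cinner (M x) y = cinner (F x) (F y)"
proof -
  have "bounded_bilinear (\<lambda>x y. inner (F x) (F y))"
    by (rule bounded_bilinear.comp[OF bounded_bilinear_inner assms(1) assms(1)])
  from bounded_bilinear_form_representation[OF this]
  obtain M where M: "bounded_linear M" "\<And>x y. inner (M x) y = inner (F x) (F y)" by auto
  then show ?thesis
    by (intro exI[of _ "Blinfun M"]) (simp add: bounded_linear_Blinfun_apply cinner_eq M(2) F)
qed

text \<open>The polar decomposition \<open>L = U P\<close> of a bounded bijection, with \<open>\<omega>\<close> the inverse of \<open>U\<close>.\<close>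

lemma polar_decomposition_exists:
  fixes V W :: "'a::complex_hilbert set"
  assumes V: "closed_csubspace V" and W: "closed_csubspace W"
    and L: "clinear_on V L" "\<And>x. x \<in> V \<Longrightarrow> L x \<in> W" "\<And>x. x \<in> V \<Longrightarrow> norm (L x) \<le> K * norm x"
      "\<And>x. x \<in> V \<Longrightarrow> \<delta> * norm x \<le> norm (L x)" "\<And>y. y \<in> W \<Longrightarrow> \<exists>x\<in>V. L x = y"
    and "0 < \<delta>"
  shows "\<exists>\<omega>. clinear_on W \<omega> \<and> \<omega> ` W = V \<and> (\<forall>y\<in>W. \<forall>y'\<in>W. cinner (\<omega> y) (\<omega> y') = cinner y y') \<and>
    (\<forall>x\<in>V. 0 \<le> inner (\<omega> (L x)) x)"
proof -
  note Vs = csubspace_simps[OF V] and Ws = csubspace_simps[OF W]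
  have V': "subspace V" "closed V"
    using V complex_subspace_imp_subspace by (auto simp: closed_csubspace_def)
  define p where "p = proj V"
  note p = proj_mem[OF V, folded p_def] proj_id[OF V, folded p_def] bounded_linear_proj[OF V, folded p_def]
  have L0: "L 0 = 0"
    using clinear_on_diff[OF L(1) _ Vs(1) Vs(1)] V by (simp add: closed_csubspace_def)
  \<comment> \<open>Extends \<open>L\<close> to the whole space by the identity on the orthogonal
    complement of \<open>V\<close>. The resulting \<open>M\<close> is coercive everywhere, so that
    its square root can be taken as an operator on the whole space.\<close>
  define F where "F x = (L (p x), x - p x)" for x
  have Fc: "F (c *\<^sub>C x) = c *\<^sub>C F x" for c x
    by (simp add: F_def scaleC_prod_def p_def proj_scaleC[OF V] scaleC_simps
        clinear_on_scaleC[OF L(1)] proj_mem[OF V])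
  have "bounded_linear (\<lambda>x. L (p x))"
  proof (rule bounded_linear_intro)
    fix x
    have "norm (L (p x)) \<le> \<bar>K\<bar> * norm (p x)"
      using L(3)[OF p(1), of x] mult_right_mono[OF abs_ge_self[of K] norm_ge_zero[of "p x"]] by linarith
    also have "\<dots> \<le> \<bar>K\<bar> * norm x"
      by (simp add: mult_left_mono norm_proj_le[OF V] p_def)
    finally show "norm (L (p x)) \<le> norm x * \<bar>K\<bar>" by (simp add: mult.commute)
  qed (simp_all add: p_def proj_add[OF V] proj_scaleC[OF V] proj_mem[OF V]
      clinear_on_add[OF L(1)] clinear_on_scaleC[OF L(1)] flip: scaleC_of_real)
  then have "bounded_linear F"
    unfolding F_def by (intro bounded_linear_Pair bounded_linear_sub bounded_linear_ident p(3))
  from adjoint_product_exists[OF this Fc]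
  obtain M :: "'a \<Rightarrow>\<^sub>L 'a" where M: "\<And>x y. cinner (M x) y = cinner (F x) (F y)" by blast
  have M_L: "cinner (M x) y = cinner (L x) (L y)" if "x \<in> V" "y \<in> V" for x y
    using that by (simp add: M F_def p(2) cinner_prod_def)
  have "min (\<delta>\<^sup>2) 1 * (norm x)\<^sup>2 \<le> inner (M x) x" for x
  proof -
    have "\<delta>\<^sup>2 * (norm (p x))\<^sup>2 \<le> (norm (L (p x)))\<^sup>2"
      using L(4)[OF p(1), of x] \<open>0 < \<delta>\<close> power_mono[of "\<delta> * norm (p x)" _ 2] by (simp add: power_mult_distrib)
    then have "min (\<delta>\<^sup>2) 1 * (norm (p x))\<^sup>2 \<le> (norm (L (p x)))\<^sup>2"
      using mult_right_mono[OF min.cobounded1[of "\<delta>\<^sup>2" 1] zero_le_power2[of "norm (p x)"]] by linarith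
    moreover have "min (\<delta>\<^sup>2) 1 * (norm (x - p x))\<^sup>2 \<le> (norm (x - p x))\<^sup>2"
      by (simp add: mult_left_le_one_le)
    ultimately have "min (\<delta>\<^sup>2) 1 * (norm x)\<^sup>2 \<le> inner (F x) (F x)"
      unfolding proj_pythagoras[OF V, of x, folded p_def] distrib_left
      by (simp add: F_def inner_prod_def power2_norm_eq_inner)
    then show ?thesis
      by (metis M Re_cinner)
  qed
  moreover have "cinner (M x) y = cinner x (M y)" for x y
    using M[of x y] M[of y x] cinner_commute by metis
  \<comment> \<open>The component \<open>q\<close> of \<open>M x\<close> orthogonal to
    \<open>V\<close> is orthogonal to \<open>M x\<close> itself, because
    \<open>F x = (L x, 0)\<close> and \<open>F q = (0, q)\<close>.\<close>
  moreover have "M x \<in> V" if x: "x \<in> V" for x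
  proof -
    define q where "q = M x - p (M x)"
    have q: "cinner q v = 0" if "v \<in> V" for v
      using proj_orth[OF V that] by (simp add: q_def p_def)
    then have "p q = 0"
      unfolding p_def by (rule proj_eq_0[OF V])
    then have "cinner (M x) q = 0"
      using x by (simp add: M F_def p(2) cinner_prod_def L0)
    moreover have "cinner (p (M x)) q = 0"
      using q[OF p(1)] cinner_commute[of "p (M x)" q] by simp
    ultimately have "cinner q q = 0"
      by (simp add: q_def cinner_diff_left)
    then show ?thesis
      using p(1)[of "M x"] by (simp add: cinner_self q_def)
  qed
  moreover have "0 < min (\<delta>\<^sup>2) 1" using \<open>0 < \<delta>\<close> by simp
  ultimately obtain P :: "'a \<Rightarrow>\<^sub>L 'a" and d where P: "\<And>x. P (P x) = M x" "0 < d"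
      "\<And>x. d * (norm x)\<^sup>2 \<le> inner (P x) x" "\<And>x y. cinner (P x) y = cinner x (P y)"
      "\<And>x. x \<in> V \<Longrightarrow> P x \<in> V"
    using positive_square_root_exists[of "min (\<delta>\<^sup>2) 1" M V] V' by metis
  \<comment> \<open>As a bounded operator of the library \<open>P\<close> is only real linear;
    complex linearity comes from its symmetry for \<open>cinner\<close>.\<close>
  have Pc: "P (c *\<^sub>C x) = c *\<^sub>C P x" for c x
    by (rule cinner_right_eqI) (simp add: P(4) cinner_scaleC_left)
  define J where "J y = (SOME x. x \<in> V \<and> L x = y)" for y
  have J: "J y \<in> V" "L (J y) = y" if "y \<in> W" for y
    using someI_ex[of "\<lambda>x. x \<in> V \<and> L x = y"] L(5)[OF that] by (auto simp: J_def)
  have inj: "x = y" if "x \<in> V" "y \<in> V" "L x = L y" for x y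
  proof -
    have "L (x - y) = 0"
      using clinear_on_diff[OF L(1) _ that(1,2)] V that(3) by (simp add: closed_csubspace_def)
    then have "\<delta> * norm (x - y) \<le> 0"
      using L(4)[of "x - y"] Vs that by simp
    then show ?thesis using \<open>0 < \<delta>\<close> by (simp add: mult_le_0_iff)
  qed
  have JL: "J (L x) = x" if "x \<in> V" for x
    using inj J that L(2) by blast
  have J_lin: "clinear_on W J"
  proof (rule clinear_onI)
    fix x y assume "x \<in> W" "y \<in> W"
    then show "J (x + y) = J x + J y"
      using J by - (rule inj; simp add: Vs Ws clinear_on_add[OF L(1)])
  next
    fix c x assume "x \<in> W"
    then show "J (c *\<^sub>C x) = c *\<^sub>C J x"
      using J by - (rule inj; simp add: Vs Ws clinear_on_scaleC[OF L(1)])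
  qed
  \<comment> \<open>With \<open>U\<close> equal to \<open>L\<close> after the inverse of
    \<open>P\<close>, this is the inverse of \<open>U\<close>. It is isometric because
    \<open>P\<close> squared is \<open>M\<close>, whose form on \<open>V\<close> is that of
    \<open>L\<close>, and \<open>\<omega> (L x) = P x\<close> gives positivity.\<close>
  define \<omega> where "\<omega> y = P (J y)" for y
  have "clinear_on W \<omega>"
    using J_lin by (auto simp: clinear_on_def \<omega>_def blinfun.add_right Pc)
  moreover have "\<omega> ` W = V"
  proof (intro equalityI image_subsetI subsetI)
    fix x assume "x \<in> V"
    have "\<exists>x'\<in>V. P x' = x"
      by (rule lax_milgram[OF V', of _ "norm P" d])
        (use P \<open>x \<in> V\<close> in \<open>auto simp: norm_blinfun blinfun.diff_right\<close>)
    then show "x \<in> \<omega> ` W"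
      using L(2) JL by (force simp: \<omega>_def)
  qed (simp add: \<omega>_def P(5) J)
  moreover have "cinner (\<omega> y) (\<omega> y') = cinner y y'" if "y \<in> W" "y' \<in> W" for y y'
    using that M_L by (simp add: \<omega>_def P(1) J flip: P(4))
  moreover have "0 \<le> inner (\<omega> (L x)) x" if "x \<in> V" for x
    using order_trans[OF _ P(3), of 0 x] P(2) that by (simp add: \<omega>_def JL)
  ultimately show ?thesis by blast
qed

section \<open>The von Neumann decomposition\<close>

lemma operator_add: "complex_vector.subspace S \<Longrightarrow> (f, f') \<in> S \<Longrightarrow> (g, g') \<in> S \<Longrightarrow> (f + g, f' + g') \<in> S"
  and operator_diff: "complex_vector.subspace S \<Longrightarrow> (f, f') \<in> S \<Longrightarrow> (g, g') \<in> S \<Longrightarrow> (f - g, f' - g') \<in> S"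
  and operator_scaleC: "complex_vector.subspace S \<Longrightarrow> (f, f') \<in> S \<Longrightarrow> (c *\<^sub>C f, c *\<^sub>C f') \<in> S"
  using complex_vector.subspace_add[of S "(f, f')" "(g, g')"] complex_vector.subspace_diff[of S "(f, f')" "(g, g')"]
    complex_vector.subspace_scale[of S "(f, f')" c]
  by (simp_all add: scaleC_prod_def)

section \<open>Eigenelements of the adjoint, the boundary form and defect components\<close>

definition eig :: "complex \<Rightarrow> 'a \<Rightarrow> 'a \<times> 'a::complex_inner"
  where "eig z x = (x, z *\<^sub>C x)"

text \<open>The left-hand side of Green's identity, taken on elements of graphs so that it applies
  to sums and differences of pairs.\<close>

definition bform :: "'a \<times> 'a \<Rightarrow> 'a \<times> 'a::complex_inner \<Rightarrow> complex"
  where "bform F G = cinner (snd F) (fst G) - cinner (fst F) (snd G)"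

text \<open>The component in the defect space at \<open>z\<close> of the decomposition of the adjoint into \<open>A\<close> and the
  eigenspaces at \<open>z\<close> and \<open>cnj z\<close>: applying \<open>A\<^sup>* - cnj z\<close> to it leaves an element of the range of
  \<open>A - cnj z\<close>, plus \<open>z - cnj z\<close> times the component, which is orthogonal to that range.\<close>

definition defect_component :: "'a::complex_inner operator \<Rightarrow> complex \<Rightarrow> 'a \<times> 'a \<Rightarrow> 'a"
  where "defect_component A z F = proj (defect_space A z) ((1 / (z - cnj z)) *\<^sub>C (snd F - cnj z *\<^sub>C fst F))"

lemma eig_in_adjoint: "eig z x \<in> adjoint_op A \<longleftrightarrow> x \<in> defect_space A z"
  by (simp add: eig_def defect_space_def)

lemma eig_add: "eig z (x + y) = eig z x + eig z y"
  and eig_diff: "eig z (x - y) = eig z x - eig z y"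
  and eig_scaleC: "eig z (c *\<^sub>C x) = c *\<^sub>C eig z x"
  and eig_zero: "eig z 0 = 0"
  by (simp_all add: eig_def scaleC_prod_def scaleC_simps mult.commute zero_prod_def)

lemma bform_diff_left: "bform (F - F') G = bform F G - bform F' G"
  and bform_diff_right: "bform G (F - F') = bform G F - bform G F'"
  and bform_add_left: "bform (F + F') G = bform F G + bform F' G"
  and bform_add_right: "bform G (F + F') = bform G F + bform G F'"
  by (simp_all add: bform_def cinner_simps)

lemma bform_eig: "bform (eig z x) (eig w y) = (z - cnj w) * cinner x y"
  by (simp add: bform_def eig_def cinner_simps algebra_simps)

lemma adjoint_op_iff:
  "G \<in> adjoint_op A \<longleftrightarrow> (\<forall>f f'. (f, f') \<in> A \<longrightarrow> cinner f' (fst G) = cinner f (snd G))"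
  by (cases G) (auto simp: adjoint_op_def)

lemma closed_csubspace_adjoint: "closed_csubspace (adjoint_op A)"
proof -
  have "adjoint_op A = (\<Inter>(f, f')\<in>A. {G. cinner f' (fst G) = cinner f (snd G)})"
    by (force simp: adjoint_op_iff)
  moreover have "closed {G. cinner f' (fst G) = cinner f (snd G)}" for f f' :: 'a
    by (intro closed_Collect_eq continuous_intros)
  ultimately have "closed (adjoint_op A)" by auto
  then show ?thesis
    by (simp add: closed_csubspace_def complex_vector.subspace_def adjoint_op_iff cinner_simps
        scaleC_prod_def)
qed

lemma closed_csubspace_defect: "closed_csubspace (defect_space A z)"
proof -
  note adj = closed_csubspace_adjoint[of A]
  have "defect_space A z = eig z -` adjoint_op A"
    by (simp add: vimage_def eig_in_adjoint)
  moreover have "closed (eig z -` adjoint_op A)"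
    unfolding eig_def using adj
    by (intro closed_vimage continuous_intros) (auto simp: closed_csubspace_def)
  moreover have "complex_vector.subspace (defect_space A z)"
    by (rule complex_vector.subspaceI)
      (simp_all add: eig_in_adjoint[symmetric] eig_add eig_scaleC eig_zero csubspace_simps[OF adj])
  ultimately show ?thesis by (simp add: closed_csubspace_def)
qed

lemma defect_component_add: "defect_component A z (F + G) = defect_component A z F + defect_component A z G"
  for A :: "'a::complex_hilbert operator"
  unfolding defect_component_def proj_add[OF closed_csubspace_defect, symmetric]
  by (rule arg_cong) (simp add: scaleC_simps algebra_simps)

lemma defect_component_scaleC: "defect_component A z (c *\<^sub>C F) = c *\<^sub>C defect_component A z F"
  for A :: "'a::complex_hilbert operator"
  unfolding defect_component_def proj_scaleC[OF closed_csubspace_defect, symmetric]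
  by (rule arg_cong) (simp add: scaleC_simps scaleC_prod_def mult_ac)

lemma defect_component_diff: "defect_component A z (F - G) = defect_component A z F - defect_component A z G"
  for A :: "'a::complex_hilbert operator"
  using defect_component_add[of A z F "(-1) *\<^sub>C G"] defect_component_scaleC[of A z "-1" G] by simp

lemma defect_component_mem: "defect_component A z F \<in> defect_space A z"
  for A :: "'a::complex_hilbert operator"
  unfolding defect_component_def by (rule proj_mem[OF closed_csubspace_defect])

text \<open>On \<open>eig \<zeta> x\<close> the operator \<open>A\<^sup>* - cnj z\<close> acts as
  multiplication by \<open>\<zeta> - cnj z\<close>. In particular the component vanishes for
  \<open>\<zeta> = cnj z\<close>.\<close>

lemma defect_component_eig:
  "defect_component A z (eig \<zeta> x) = ((\<zeta> - cnj z) / (z - cnj z)) *\<^sub>C proj (defect_space A z) x"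
  for A :: "'a::complex_hilbert operator"
  unfolding defect_component_def proj_scaleC[OF closed_csubspace_defect, symmetric]
  by (rule arg_cong) (simp add: eig_def scaleC_simps divide_inverse mult.commute flip: complex_vector.scale_left_diff_distrib)

lemma diff_cnj_nonzero: "Im z \<noteq> 0 \<Longrightarrow> z - cnj z \<noteq> 0" "Im z \<noteq> 0 \<Longrightarrow> cnj z - z \<noteq> 0"
  by (auto simp: complex_eq_iff)

lemma defect_component_eig_same:
  fixes A :: "'a::complex_hilbert operator"
  assumes "Im z \<noteq> 0" "x \<in> defect_space A z"
  shows "defect_component A z (eig z x) = x"
  using assms(2) diff_cnj_nonzero(1)[OF assms(1)]
  by (simp add: defect_component_eig proj_id[OF closed_csubspace_defect])

lemma defect_component_eig_cnj: "defect_component A z (eig (cnj z) x) = 0"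
  for A :: "'a::complex_hilbert operator"
  by (simp add: defect_component_eig)

lemma norm_defect_component_eig_le:
  "norm (defect_component A z (eig \<zeta> x)) \<le> cmod ((\<zeta> - cnj z) / (z - cnj z)) * norm x"
  for A :: "'a::complex_hilbert operator"
  unfolding defect_component_eig norm_scaleC
  by (intro mult_left_mono norm_proj_le[OF closed_csubspace_defect]) simp

section \<open>Von Neumann's formula and Green's identity for closed symmetric operators\<close>

context
  fixes A :: "'a::complex_hilbert operator"
  assumes lin: "complex_vector.subspace A" and cl: "closed A" and sym: "symmetric_operator A"
begin

lemma symmetric_subset_adjoint: "A \<subseteq> adjoint_op A"
  using sym by (fastforce simp: symmetric_operator_def adjoint_op_def)

lemma bform_symmetric:
  assumes "F \<in> A" "G \<in> adjoint_op A"
  shows "bform F G = 0" "bform G F = 0"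
proof -
  obtain f f' g g' where FG: "F = (f, f')" "G = (g, g')" by fastforce
  then have *: "cinner f' g = cinner f g'"
    using assms by (auto simp: adjoint_op_def)
  then show "bform F G = 0" by (simp add: bform_def FG)
  have "cinner g f' = cinner g' f"
    using * cinner_commute by metis
  then show "bform G F = 0" by (simp add: bform_def FG)
qed

lemma range_orth_defect:
  assumes "(f, f') \<in> A" "v \<in> defect_space A (cnj w)"
  shows "cinner (f' - w *\<^sub>C f) v = 0"
  using assms by (auto simp: defect_space_def adjoint_op_def cinner_simps)

text \<open>\<open>cinner f' f\<close> is real by symmetry, so the imaginary part of
  \<open>cinner (f' - w *\<^sub>C f) f\<close> is \<open>- Im w * (norm f)\<^sup>2\<close>;
  Cauchy-Schwarz finishes.\<close>

lemma norm_range_ge: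
  assumes "(f, f') \<in> A"
  shows "\<bar>Im w\<bar> * norm f \<le> norm (f' - w *\<^sub>C f)"
proof (cases "f = 0")
  case False
  have "cinner f' f = cinner f f'"
    using sym assms by (auto simp: symmetric_operator_def)
  then have "Im (cinner f' f) = 0"
    using cinner_commute[of f f'] by (metis Im_complex_of_real Reals_cnj_iff Reals_cases)
  then have "Im (cinner (f' - w *\<^sub>C f) f) = - Im w * (norm f)\<^sup>2"
    by (simp add: cinner_simps cinner_self flip: of_real_power)
  then have "\<bar>Im w\<bar> * (norm f)\<^sup>2 = \<bar>Im (cinner (f' - w *\<^sub>C f) f)\<bar>"
    by (simp add: abs_mult)
  also have "\<dots> \<le> norm (f' - w *\<^sub>C f) * norm f"
    using abs_Im_le_cmod norm_cinner_le order_trans by blast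
  finally have "(\<bar>Im w\<bar> * norm f) * norm f \<le> norm (f' - w *\<^sub>C f) * norm f"
    by (simp add: power2_eq_square mult.assoc)
  then show ?thesis using False by simp
qed simp

text \<open>By the lower bound, preimages of a convergent sequence in the range are Cauchy;
  closedness of \<open>A\<close> puts their limit into \<open>A\<close>.\<close>

lemma closed_csubspace_range:
  assumes w: "Im w \<noteq> 0"
  shows "closed_csubspace {f' - w *\<^sub>C f | f f'. (f, f') \<in> A}" (is "closed_csubspace ?R")
proof -
  have "closed ?R"
    unfolding closed_sequential_limits
  proof (intro allI impI, elim conjE)
    fix h l assume h: "\<forall>n. h n \<in> ?R" and l: "h \<longlonglongrightarrow> l"
    have "\<exists>F. F \<in> A \<and> h n = snd F - w *\<^sub>C fst F" for n
      using spec[OF h, of n] by force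
    then obtain F where F: "\<And>n. F n \<in> A" "\<And>n. h n = snd (F n) - w *\<^sub>C fst (F n)"
      by metis
    define f f' where "f n = fst (F n)" and "f' n = snd (F n)" for n
    have f: "(f n, f' n) \<in> A" "h n = f' n - w *\<^sub>C f n" for n
      using F[of n] by (simp_all add: f_def f'_def)
    have "Cauchy f"
    proof (rule metric_CauchyI)
      fix e :: real assume "0 < e"
      then have "0 < \<bar>Im w\<bar> * e" using w by simp
      from metric_CauchyD[OF LIMSEQ_imp_Cauchy[OF l] this]
      obtain N where N: "\<And>m n. m \<ge> N \<Longrightarrow> n \<ge> N \<Longrightarrow> dist (h m) (h n) < \<bar>Im w\<bar> * e"
        by blast
      show "\<exists>M. \<forall>m\<ge>M. \<forall>n\<ge>M. dist (f m) (f n) < e"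
      proof (intro exI[of _ N] allI impI)
        fix m n assume mn: "N \<le> m" "N \<le> n"
        have "\<bar>Im w\<bar> * norm (f m - f n) \<le> norm ((f' m - f' n) - w *\<^sub>C (f m - f n))"
          by (rule norm_range_ge) (rule operator_diff[OF lin f(1) f(1)])
        also have "(f' m - f' n) - w *\<^sub>C (f m - f n) = h m - h n"
          by (simp add: f(2) scaleC_simps)
        finally have "\<bar>Im w\<bar> * norm (f m - f n) < \<bar>Im w\<bar> * e"
          using N[OF mn] by (simp add: dist_norm)
        then show "dist (f m) (f n) < e"
          using w by (simp add: dist_norm)
      qed
    qed
    then obtain g where g: "f \<longlonglongrightarrow> g"
      by (auto simp: Cauchy_convergent_iff convergent_def)
    have "(\<lambda>n. h n + w *\<^sub>C f n) \<longlonglongrightarrow> l + w *\<^sub>C g"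
      by (intro tendsto_add l bounded_linear.tendsto[OF bounded_linear_scaleC] g)
    then have "f' \<longlonglongrightarrow> l + w *\<^sub>C g" by (simp add: f(2))
    then have "(\<lambda>n. (f n, f' n)) \<longlonglongrightarrow> (g, l + w *\<^sub>C g)"
      by (intro tendsto_Pair g)
    from closed_sequentially[OF cl f(1) this] have "(g, l + w *\<^sub>C g) \<in> A" .
    then show "l \<in> ?R" by force
  qed
  moreover have "complex_vector.subspace ?R"
  proof (rule complex_vector.subspaceI)
    have "(0, 0) \<in> A" using complex_vector.subspace_0[OF lin] by (simp add: zero_prod_def)
    then show "0 \<in> ?R" by (intro CollectI exI[of _ 0]) simp
    fix x y assume "x \<in> ?R" "y \<in> ?R"
    then obtain f f' g g' where "(f, f') \<in> A" "(g, g') \<in> A" "x = f' - w *\<^sub>C f" "y = g' - w *\<^sub>C g"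
      by auto
    then show "x + y \<in> ?R"
      by (intro CollectI exI[of _ "f + g"] exI[of _ "f' + g'"])
        (simp add: scaleC_simps operator_add[OF lin])
  next
    fix c x assume "x \<in> ?R"
    then obtain f f' where "(f, f') \<in> A" "x = f' - w *\<^sub>C f" by auto
    then show "c *\<^sub>C x \<in> ?R"
      by (intro CollectI exI[of _ "c *\<^sub>C f"] exI[of _ "c *\<^sub>C f'"])
        (simp add: scaleC_simps operator_scaleC[OF lin] mult.commute)
  qed
  ultimately show ?thesis by (simp add: closed_csubspace_def)
qed

text \<open>The remainder \<open>s\<close> of projecting \<open>h\<close> onto the closed range of
  \<open>A - w\<close> lies in the defect space at \<open>cnj w\<close>. It is then orthogonal both
  to \<open>h\<close> and to the projection, hence zero.\<close>

lemma range_eq_defect_orth: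
  assumes w: "Im w \<noteq> 0" and h: "\<And>v. v \<in> defect_space A (cnj w) \<Longrightarrow> cinner h v = 0"
  obtains f f' where "(f, f') \<in> A" "h = f' - w *\<^sub>C f"
proof -
  let ?R = "{f' - w *\<^sub>C f | f f'. (f, f') \<in> A}"
  note R = closed_csubspace_range[OF w]
  define s where "s = h - proj ?R h"
  have orth: "cinner s r = 0" if "r \<in> ?R" for r
    unfolding s_def by (rule proj_orth[OF R that])
  have "s \<in> defect_space A (cnj w)"
    unfolding defect_space_def adjoint_op_def
  proof clarsimp
    fix f f' assume "(f, f') \<in> A"
    then have "cinner s (f' - w *\<^sub>C f) = 0" using orth by blast
    then have "cinner (f' - w *\<^sub>C f) s = 0" using cinner_commute by (metis complex_cnj_zero)
    then show "cinner f' s = cinner f (cnj w *\<^sub>C s)"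
      by (simp add: cinner_simps)
  qed
  then have "cinner h s = 0" by (rule h)
  moreover have "cinner (proj ?R h) s = 0"
    using orth[OF proj_mem[OF R]] cinner_commute[of "proj ?R h" s] by simp
  ultimately have "cinner s s = 0"
    by (simp add: s_def cinner_diff_left)
  then have "h = proj ?R h" by (simp add: cinner_self s_def)
  then have "h \<in> ?R" using proj_mem[OF R, of h] by simp
  then show thesis using that by blast
qed

text \<open>For the difference \<open>G\<close>, the images under \<open>A\<^sup>* - w\<close> and
  \<open>A\<^sup>* - cnj w\<close> are orthogonal to the defect spaces at \<open>cnj w\<close> and
  \<open>w\<close>. The first fact makes \<open>G\<close> an element of \<open>A\<close> plus
  \<open>eig w d\<close>; the second forces \<open>d = 0\<close>.\<close>

lemma von_neumann_decomposition:
  assumes w: "Im w \<noteq> 0" and F: "F \<in> adjoint_op A"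
  shows "F - eig (cnj w) (defect_component A (cnj w) F) - eig w (defect_component A w F) \<in> A"
proof -
  note adj = csubspace_simps[OF closed_csubspace_adjoint[of A]]
  define G where "G = F - eig (cnj w) (defect_component A (cnj w) F) - eig w (defect_component A w F)"
  have "G \<in> adjoint_op A"
    unfolding G_def by (intro adj F) (simp_all add: eig_in_adjoint defect_component_mem)
  have orth: "cinner (snd G - cnj z *\<^sub>C fst G) v = 0"
    if z: "z = w \<or> z = cnj w" and v: "v \<in> defect_space A z" for z v
  proof -
    define y where "y = snd F - cnj z *\<^sub>C fst F"
    have z': "z - cnj z \<noteq> 0" using z diff_cnj_nonzero[OF w] by auto
    have "snd G - cnj z *\<^sub>C fst G = y - (z - cnj z) *\<^sub>C defect_component A z F"
      using z by (auto simp: G_def y_def eig_def scaleC_simps)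
    also have "(z - cnj z) *\<^sub>C defect_component A z F = proj (defect_space A z) y"
      using z' by (simp add: defect_component_def y_def proj_scaleC[OF closed_csubspace_defect] scaleC_scaleC)
    finally show ?thesis
      using proj_orth[OF closed_csubspace_defect v] by simp
  qed
  obtain a a' where a: "(a, a') \<in> A" "snd G - w *\<^sub>C fst G = a' - w *\<^sub>C a"
    by (rule range_eq_defect_orth[OF w, of "snd G - w *\<^sub>C fst G"]) (use orth[of "cnj w"] in auto)
  define d where "d = fst G - a"
  have d': "snd G - a' = w *\<^sub>C d"
    using a(2) by (simp add: d_def scaleC_simps algebra_simps)
  have "G - (a, a') \<in> adjoint_op A"
    by (intro adj \<open>G \<in> adjoint_op A\<close>) (use a(1) symmetric_subset_adjoint in auto)
  moreover have "G - (a, a') = eig w d"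
    using d' by (simp add: eig_def d_def prod_eq_iff)
  ultimately have d: "d \<in> defect_space A w"
    by (simp add: eig_in_adjoint)
  have "(w - cnj w) *\<^sub>C d = (snd G - cnj w *\<^sub>C fst G) - (a' - cnj w *\<^sub>C a)"
    using d' by (simp add: d_def scaleC_simps algebra_simps)
  moreover have "cinner (a' - cnj w *\<^sub>C a) d = 0"
    using range_orth_defect[OF a(1), of d "cnj w"] d by simp
  ultimately have "cinner ((w - cnj w) *\<^sub>C d) d = 0"
    using orth[of w d] d by (simp add: cinner_diff_left)
  then have "d = 0"
    using diff_cnj_nonzero[OF w] by (simp add: cinner_scaleC_left cinner_self)
  then have "G = (a, a')"
    using d' by (simp add: d_def prod_eq_iff)
  then show ?thesis
    using a(1) by (simp add: G_def)
qed

text \<open>The form pairs \<open>A\<close> with its adjoint to zero, so only the two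
  eigencomponents count; their mixed terms vanish because the factor \<open>z - cnj w\<close> in
  \<open>bform_eig\<close> is zero for conjugate eigenvalues.\<close>

lemma green_identity:
  assumes w: "Im w \<noteq> 0" and F: "F \<in> adjoint_op A" and G: "G \<in> adjoint_op A"
  shows "bform F G = (cnj w - w) *
    (cinner (defect_component A (cnj w) F) (defect_component A (cnj w) G) -
     cinner (defect_component A w F) (defect_component A w G))"
proof -
  define E where "E F = eig (cnj w) (defect_component A (cnj w) F) + eig w (defect_component A w F)" for F
  have E: "F - E F \<in> A" "E F \<in> adjoint_op A" if "F \<in> adjoint_op A" for F
    using von_neumann_decomposition[OF w that] csubspace_simps(2)[OF closed_csubspace_adjoint[of A]]
    by (simp_all add: E_def algebra_simps eig_in_adjoint defect_component_mem)
  have "bform F G = bform (E F) G"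
    using bform_symmetric(1)[OF E(1)[OF F] G] by (simp add: bform_diff_left)
  also have "\<dots> = bform (E F) (E G)"
    using bform_symmetric(2)[OF E(1)[OF G] E(2)[OF F]] by (simp add: bform_diff_right)
  also have "\<dots> = (cnj w - w) *
    (cinner (defect_component A (cnj w) F) (defect_component A (cnj w) G) -
     cinner (defect_component A w F) (defect_component A w G))"
    by (simp add: E_def bform_add_left bform_add_right bform_eig algebra_simps)
  finally show ?thesis .
qed

text \<open>Green's identity for \<open>eig z n\<close> paired with itself. It makes the eigenspace
  at \<open>z\<close> positive or negative according to the sign of \<open>Im z\<close>.\<close>

lemma defect_component_norms:
  assumes w: "Im w \<noteq> 0" and n: "n \<in> defect_space A z"
  shows "Im z * (norm n)\<^sup>2 = - Im w * ((norm (defect_component A (cnj w) (eig z n)))\<^sup>2 -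
    (norm (defect_component A w (eig z n)))\<^sup>2)"
proof -
  have "eig z n \<in> adjoint_op A" using n by (simp add: eig_in_adjoint)
  from green_identity[OF w this this] show ?thesis
    unfolding bform_eig cinner_self by (simp add: complex_eq_iff flip: of_real_diff of_real_power)
qed

text \<open>This is the maximality of the positive eigenspace at \<open>z\<close>. Mapping
  \<open>V\<close> to the defect space at \<open>z\<close> and back gives \<open>G\<close>, which is
  coercive by Green's identity taken with respect to \<open>z\<close>, so that Lax-Milgram
  applies.\<close>

lemma defect_component_onto:
  assumes w: "Im w < 0" and z: "0 < Im z" and x: "x \<in> defect_space A (cnj w)"
  shows "\<exists>n\<in>defect_space A z. defect_component A (cnj w) (eig z n) = x"
proof -
  let ?V = "defect_space A (cnj w)"
  note V = closed_csubspace_defect[of A "cnj w"]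
  define N where "N x = defect_component A z (eig (cnj w) x)" for x
  define G where "G x = defect_component A (cnj w) (eig z (N x))" for x
  have zw: "z - w \<noteq> 0" "z - cnj z \<noteq> 0" "cnj w - w \<noteq> 0" "cnj z - z \<noteq> 0"
    using w z by (auto simp: complex_eq_iff)
  \<comment> \<open>Up to scalars \<open>N\<close> and \<open>G\<close> consist of orthogonal
    projections, so \<open>cinner (G y) y\<close> is a multiple of
    \<open>cinner (N y) (N y)\<close>. The scalars combine to the positive number
    \<open>Im z / - Im w\<close>.\<close>
  have G_inner: "inner (G y) y = (Im z / - Im w) * (norm (N y))\<^sup>2" if y: "y \<in> ?V" for y
  proof -
    let ?c = "(cnj w - cnj z) / (z - cnj z)"
    have N: "N y = proj (defect_space A z) (?c *\<^sub>C y)"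
      by (simp add: N_def defect_component_eig proj_scaleC[OF closed_csubspace_defect])
    have "cinner (N y) (N y) = cinner (?c *\<^sub>C y) (N y)"
      unfolding N by (rule cinner_proj_left[OF closed_csubspace_defect proj_mem[OF closed_csubspace_defect]])
    then have "cinner (N y) (N y) = cinner (N y) (?c *\<^sub>C y)"
      using cinner_commute by metis
    also have "\<dots> = (z - w) / (z - cnj z) * cinner (N y) y"
      using zw by (simp add: cinner_simps field_simps)
    finally have 1: "cinner (N y) y = (z - cnj z) / (z - w) * cinner (N y) (N y)"
      using zw by simp
    have "cinner (G y) y = (z - w) / (cnj w - w) * cinner (N y) y"
      by (simp add: G_def defect_component_eig cinner_simps cinner_proj_left[OF V y])
    also have "\<dots> = (z - cnj z) / (cnj w - w) * cinner (N y) (N y)"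
      unfolding 1 using zw by simp
    also have "(z - cnj z) / (cnj w - w) = complex_of_real (Im z / - Im w)"
      using w zw(3) by (subst nonzero_divide_eq_eq) (simp_all add: complex_eq_iff)
    finally have "cinner (G y) y = complex_of_real ((Im z / - Im w) * (norm (N y))\<^sup>2)"
      by (simp only: cinner_self of_real_mult)
    then show ?thesis
      by (metis Re_cinner Re_complex_of_real)
  qed
  have "\<exists>y\<in>?V. G y = x"
  proof (rule lax_milgram[of ?V G _ 1])
    show "subspace ?V" "closed ?V"
      using V complex_subspace_imp_subspace by (auto simp: closed_csubspace_def)
    show "G y \<in> ?V" for y by (simp add: G_def defect_component_mem)
    show "G (y - y') = G y - G y'" for y y'
      by (simp add: G_def N_def eig_diff defect_component_diff)
    show "norm (G y) \<le> (cmod ((z - w) / (cnj w - w)) * cmod ((cnj w - cnj z) / (z - cnj z))) * norm y" for y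
    proof -
      have "norm (G y) \<le> cmod ((z - w) / (cnj w - w)) * norm (N y)"
        using norm_defect_component_eig_le[of A "cnj w" z "N y"] by (simp add: G_def)
      also have "norm (N y) \<le> cmod ((cnj w - cnj z) / (z - cnj z)) * norm y"
        unfolding N_def by (rule norm_defect_component_eig_le)
      finally show ?thesis by (simp add: mult.assoc mult_left_mono)
    qed
    show "1 * (norm y)\<^sup>2 \<le> inner (G y) y" if y: "y \<in> ?V" for y
    proof -
      have "- Im w * (norm y)\<^sup>2 \<le> Im z * (norm (N y))\<^sup>2"
        using defect_component_norms[of z y "cnj w"] y z
          mult_nonneg_nonneg[OF less_imp_le[OF z] zero_le_power2[of "norm (defect_component A (cnj z) (eig (cnj w) y))"]]
        by (simp add: N_def right_diff_distrib)
      then show ?thesis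
        using w by (simp add: G_inner[OF y] field_simps)
    qed
  qed (use x in auto)
  then show ?thesis
    by (auto simp: G_def N_def defect_component_mem)
qed

end

section \<open>Construction of the boundary triplet\<close>

lemma resolvent_setE:
  assumes "z \<in> resolvent_set T"
  obtains R where "bounded_clinear R" "\<And>f f'. (f, f') \<in> T \<Longrightarrow> R (f' - z *\<^sub>C f) = f"
    "\<And>h. (R h, h + z *\<^sub>C R h) \<in> T"
proof -
  obtain R where R: "bounded_clinear R"
    and eq: "{(f' - z *\<^sub>C f, f) | f f'. (f, f') \<in> T} = {(h, R h) | h. True}"
    using assms by (auto simp: resolvent_set_def)
  have "R (f' - z *\<^sub>C f) = f" if "(f, f') \<in> T" for f f'
  proof -
    have "(f' - z *\<^sub>C f, f) \<in> {(h, R h) | h. True}"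
      unfolding eq[symmetric] using that by blast
    then show ?thesis by simp
  qed
  moreover have "(R h, h + z *\<^sub>C R h) \<in> T" for h
  proof -
    have "(h, R h) \<in> {(f' - z *\<^sub>C f, f) | f f'. (f, f') \<in> T}"
      unfolding eq by blast
    then obtain f' where "h = f' - z *\<^sub>C R h" "(R h, f') \<in> T" by auto
    then show ?thesis by (metis diff_add_cancel)
  qed
  ultimately show thesis using that R by blast
qed

lemma bounded_clinearD:
  assumes "bounded_clinear R"
  shows "R (x + y) = R x + R y" "R (x - y) = R x - R y" "R (c *\<^sub>C x) = c *\<^sub>C R x" "R 0 = 0"
    and "\<exists>k\<ge>0. \<forall>x. norm (R x) \<le> k * norm x"
proof -
  interpret bounded_linear R
    using assms by (simp add: bounded_clinear_def)
  show "R (x + y) = R x + R y" "R (x - y) = R x - R y" "R (c *\<^sub>C x) = c *\<^sub>C R x" "R 0 = 0"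
    using assms by (simp_all add: add diff zero bounded_clinear_def)
  show "\<exists>k\<ge>0. \<forall>x. norm (R x) \<le> k * norm x"
    using nonneg_bounded by (simp add: mult.commute)
qed

text \<open>\<open>R ((\<zeta> - z) *\<^sub>C x)\<close> solves
  \<open>(T - z) f = (\<zeta> - z) x\<close>, and \<open>A\<^sup>* - z\<close> also maps
  \<open>x\<close> to the right-hand side; the difference \<open>n\<close> is thus annihilated by
  \<open>A\<^sup>* - z\<close>.\<close>

lemma resolvent_decomposition:
  assumes "T \<subseteq> adjoint_op A" and R: "\<And>h. (R h, h + z *\<^sub>C R h) \<in> T" and x: "x \<in> defect_space A \<zeta>"
  defines "n \<equiv> x - R ((\<zeta> - z) *\<^sub>C x)"
  shows "n \<in> defect_space A z" "eig \<zeta> x - eig z n \<in> T"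
proof -
  have *: "eig \<zeta> x - eig z n = (R ((\<zeta> - z) *\<^sub>C x), (\<zeta> - z) *\<^sub>C x + z *\<^sub>C R ((\<zeta> - z) *\<^sub>C x))"
    by (simp add: eig_def n_def scaleC_simps)
  then show T: "eig \<zeta> x - eig z n \<in> T" using R by simp
  have "eig \<zeta> x - (eig \<zeta> x - eig z n) \<in> adjoint_op A"
    by (rule csubspace_simps(3)[OF closed_csubspace_adjoint])
      (use assms(1) T x in \<open>auto simp: eig_in_adjoint\<close>)
  then show "n \<in> defect_space A z" by (simp add: eig_in_adjoint)
qed

text \<open>Modulo \<open>A\<close>, the extension \<open>T\<close> is the graph of \<open>S\<close> and the eigenspace at \<open>z\<close> the graph of a
  strict contraction \<open>C\<close>; the polar decomposition of \<open>S - C\<close> gives \<open>\<omega>\<close>.\<close>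

lemma transversal_isometry_exists:
  fixes A T :: "'a::complex_hilbert operator"
  assumes A: "complex_vector.subspace A" "closed A" "symmetric_operator A"
    and T: "complex_vector.subspace T" "A \<subseteq> T" "T \<subseteq> adjoint_op A"
    and w: "w \<in> resolvent_set T" "Im w < 0" and z: "z \<in> resolvent_set T" "0 < Im z"
  defines "V \<equiv> defect_space A (cnj w)" and "W \<equiv> defect_space A w"
  obtains S \<omega> K c where "clinear_on V S" "\<And>x. x \<in> V \<Longrightarrow> S x \<in> W" "\<And>x. norm (S x) \<le> K * norm x"
    "\<And>F. F \<in> adjoint_op A \<Longrightarrow> F \<in> T \<longleftrightarrow> defect_component A w F = S (defect_component A (cnj w) F)"
    "clinear_on W \<omega>" "\<omega> ` W = V" "\<And>y y'. y \<in> W \<Longrightarrow> y' \<in> W \<Longrightarrow> cinner (\<omega> y) (\<omega> y') = cinner y y'"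
    "0 < c" "\<And>x. x \<in> V \<Longrightarrow> c * (norm x)\<^sup>2 \<le> inner (x + \<omega> (S x)) x"
proof -
  note V = closed_csubspace_defect[of A "cnj w", folded V_def]
  note W = closed_csubspace_defect[of A w, folded W_def]
  note Vs = csubspace_simps[OF V] and Ws = csubspace_simps[OF W]
    and Zs = csubspace_simps[OF closed_csubspace_defect[of A z]]
    and adj = csubspace_simps[OF closed_csubspace_adjoint[of A]]
  define u where "u = defect_component A (cnj w)"
  define m where "m = defect_component A w"
  have w0: "Im w \<noteq> 0" "Im (cnj w) \<noteq> 0" using w by auto
  have uV: "u F \<in> V" and mW: "m F \<in> W" for F
    by (simp_all add: u_def m_def V_def W_def defect_component_mem)
  have um_lin: "u (F + G) = u F + u G" "u (F - G) = u F - u G" "u (c *\<^sub>C F) = c *\<^sub>C u F"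
    "m (F + G) = m F + m G" "m (F - G) = m F - m G" "m (c *\<^sub>C F) = c *\<^sub>C m F" for F G c
    by (simp_all add: u_def m_def defect_component_add defect_component_diff defect_component_scaleC)
  have u_eig: "u (eig (cnj w) x) = x" "m (eig (cnj w) x) = 0" if "x \<in> V" for x
    using that w0 by (simp_all add: u_def m_def V_def defect_component_eig_same defect_component_eig_cnj)
  have m_eig: "m (eig w y) = y" "u (eig w y) = 0" if "y \<in> W" for y
    using that w0 defect_component_eig_cnj[of A "cnj w" y]
    by (simp_all add: u_def m_def W_def defect_component_eig_same)
  obtain R where R: "bounded_clinear R" "\<And>f f'. (f, f') \<in> T \<Longrightarrow> R (f' - w *\<^sub>C f) = f"
    "\<And>h. (R h, h + w *\<^sub>C R h) \<in> T"
    using resolvent_setE[OF w(1)] by blast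
  obtain R' where R': "bounded_clinear R'" "\<And>f f'. (f, f') \<in> T \<Longrightarrow> R' (f' - z *\<^sub>C f) = f"
    "\<And>h. (R' h, h + z *\<^sub>C R' h) \<in> T"
    using resolvent_setE[OF z(1)] by blast
  \<comment> \<open>The negative of the remainder in \<open>resolvent_decomposition\<close>, which
    turns the difference there into the sum \<open>eig (cnj w) x + eig w (S x)\<close> in
    \<open>T\<close>.\<close>
  define S where "S x = R ((cnj w - w) *\<^sub>C x) - x" for x
  have S_lin: "clinear_on V S"
    by (rule clinear_onI) (simp_all add: S_def scaleC_simps bounded_clinearD[OF R(1)] mult.commute right_diff_distrib)
  have S: "S x \<in> W" "eig (cnj w) x + eig w (S x) \<in> T" if "x \<in> V" for x
  proof -
    define n where "n = x - R ((cnj w - w) *\<^sub>C x)"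
    have n: "n \<in> W" "eig (cnj w) x - eig w n \<in> T"
      using resolvent_decomposition[OF T(3) R(3) that[unfolded V_def]] by (auto simp: n_def W_def)
    have "S x = - n" "eig w (- n) = - eig w n"
      using eig_diff[of w 0 n] by (simp_all add: S_def n_def eig_zero)
    then show "S x \<in> W" "eig (cnj w) x + eig w (S x) \<in> T"
      using n by (simp_all add: Ws)
  qed
  obtain k where k: "0 \<le> k" "\<And>x. norm (R x) \<le> k * norm x"
    using bounded_clinearD(5)[OF R(1)] by blast
  have S_bound: "norm (S x) \<le> (k * cmod (cnj w - w) + 1) * norm x" for x
    using norm_triangle_ineq4[of "R ((cnj w - w) *\<^sub>C x)" x] k(2)[of "(cnj w - w) *\<^sub>C x"]
    by (simp add: S_def norm_scaleC distrib_right mult.assoc)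
  have T_iff: "F \<in> T \<longleftrightarrow> m F = S (u F)" if F: "F \<in> adjoint_op A" for F
  proof -
    \<comment> \<open>\<open>F\<close> is an element of \<open>T\<close> plus
      \<open>eig w d\<close>, and \<open>eig w d\<close> lies in \<open>T\<close> only for
      \<open>d = 0\<close>, because \<open>T - w\<close> is injective.\<close>
    define d where "d = m F - S (u F)"
    define a where "a = F - eig (cnj w) (u F) - eig w (m F)"
    define E where "E = eig (cnj w) (u F) + eig w (S (u F))"
    have "a \<in> T"
      using von_neumann_decomposition[OF A w0(1) F] T(2) by (auto simp: a_def u_def m_def)
    moreover have "E \<in> T" using S(2)[OF uV] by (simp add: E_def)
    ultimately have Ea: "E + a \<in> T" using T(1) by (simp add: complex_vector.subspace_add)
    have decomp: "F = (E + a) + eig w d"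
      by (simp add: E_def a_def d_def eig_diff)
    show ?thesis
    proof
      assume "F \<in> T"
      then have "F - (E + a) \<in> T" using Ea T(1) by (simp add: complex_vector.subspace_diff)
      then have "(d, w *\<^sub>C d) \<in> T" using decomp by (simp add: eig_def)
      from R(2)[OF this] show "m F = S (u F)"
        by (simp add: bounded_clinearD(4)[OF R(1)] d_def)
    next
      assume "m F = S (u F)"
      then have "d = 0" by (simp add: d_def)
      then have "F = E + a" using decomp eig_zero by (metis add_0_right)
      then show "F \<in> T" using Ea by simp
    qed
  qed
  have norms: "Im z * (norm n)\<^sup>2 = - Im w * ((norm (u (eig z n)))\<^sup>2 - (norm (m (eig z n)))\<^sup>2)"
    if "n \<in> defect_space A z" for n
    using defect_component_norms[OF A w0(1) that] by (simp add: u_def m_def)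
  have inj: "n = 0" if n: "n \<in> defect_space A z" "u (eig z n) = 0" for n
  proof -
    have "Im z * (norm n)\<^sup>2 = Im w * (norm (m (eig z n)))\<^sup>2"
      using norms[OF n(1)] n(2) by simp
    also have "\<dots> \<le> 0" using w by (simp add: mult_nonpos_nonneg)
    finally show ?thesis using z by (simp add: mult_le_0_iff)
  qed
  have "\<forall>x\<in>V. \<exists>n. n \<in> defect_space A z \<and> u (eig z n) = x"
    using defect_component_onto[OF A w(2) z(2)] by (auto simp: V_def u_def)
  then obtain \<nu> where \<nu>: "\<And>x. x \<in> V \<Longrightarrow> \<nu> x \<in> defect_space A z" "\<And>x. x \<in> V \<Longrightarrow> u (eig z (\<nu> x)) = x"
    using bchoice by (metis (no_types, lifting))
  have \<nu>_eq: "\<nu> x = n" if "x \<in> V" "n \<in> defect_space A z" "u (eig z n) = x" for x n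
    using inj[of "\<nu> x - n"] that \<nu> by (simp add: Zs eig_diff um_lin)
  \<comment> \<open>Since \<open>u\<close> is bijective from the eigenspace at \<open>z\<close> onto
    \<open>V\<close>, with inverse \<open>\<nu>\<close>, the eigenspace is modulo \<open>A\<close>
    the graph of \<open>C\<close>.\<close>
  define C where "C x = m (eig z (\<nu> x))" for x
  have \<nu>_lin: "\<nu> (x + y) = \<nu> x + \<nu> y" "\<nu> (c *\<^sub>C x) = c *\<^sub>C \<nu> x" if "x \<in> V" "y \<in> V" for x y c
    using that by (auto intro!: \<nu>_eq simp: Vs Zs \<nu> eig_add eig_scaleC um_lin)
  have C_lin: "clinear_on V C"
    by (rule clinear_onI) (simp_all add: C_def \<nu>_lin eig_add eig_scaleC um_lin)
  define \<kappa> where "\<kappa> = cmod ((z - w) / (cnj w - w))"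
  have "z \<noteq> w" using w z by auto
  then have "\<kappa> > 0"
    using diff_cnj_nonzero(2)[OF w0(1)] by (simp add: \<kappa>_def norm_divide)
  have \<nu>_ge: "norm x \<le> \<kappa> * norm (\<nu> x)" if "x \<in> V" for x
    using norm_defect_component_eig_le[of A "cnj w" z "\<nu> x"] \<nu>(2)[OF that] by (simp add: u_def \<kappa>_def)
  \<comment> \<open>Green's identity expresses
    \<open>(norm x)\<^sup>2 - (norm (C x))\<^sup>2\<close> through \<open>norm (\<nu> x)\<close>,
    and \<open>\<nu>_ge\<close> bounds it below by \<open>q * (norm x)\<^sup>2\<close>. The maximum
    in \<open>\<gamma>\<close> covers the case \<open>q > 1\<close>.\<close>
  define q where "q = Im z / (- Im w * \<kappa>\<^sup>2)"
  have "q > 0" unfolding q_def using w z \<open>\<kappa> > 0\<close> by (intro divide_pos_pos mult_pos_pos) auto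
  define \<gamma> where "\<gamma> = sqrt (max 0 (1 - q))"
  have \<gamma>: "0 \<le> \<gamma>" "\<gamma> < 1" using \<open>q > 0\<close> by (auto simp: \<gamma>_def)
  have C_bound: "norm (C x) \<le> \<gamma> * norm x" if x: "x \<in> V" for x
  proof -
    have "(norm x)\<^sup>2 \<le> \<kappa>\<^sup>2 * (norm (\<nu> x))\<^sup>2"
      using power_mono[OF \<nu>_ge[OF x], of 2] by (simp add: power_mult_distrib)
    then have "q * (norm x)\<^sup>2 \<le> q * (\<kappa>\<^sup>2 * (norm (\<nu> x))\<^sup>2)"
      using \<open>q > 0\<close> by (intro mult_left_mono) auto
    also have "\<dots> = Im z * (norm (\<nu> x))\<^sup>2 / (- Im w)"
      using \<open>\<kappa> > 0\<close> by (simp add: q_def)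
    also have "\<dots> = (norm x)\<^sup>2 - (norm (C x))\<^sup>2"
      unfolding norms[OF \<nu>(1)[OF x]] \<nu>(2)[OF x] C_def using w by simp
    finally have "(norm (C x))\<^sup>2 \<le> (1 - q) * (norm x)\<^sup>2"
      by (simp add: algebra_simps)
    also have "\<dots> \<le> max 0 (1 - q) * (norm x)\<^sup>2"
      by (intro mult_right_mono) auto
    also have "\<dots> = (\<gamma> * norm x)\<^sup>2"
      by (simp add: \<gamma>_def power_mult_distrib)
    finally show ?thesis
      by (rule power2_le_imp_le) (simp add: \<gamma>(1))
  qed
  define L where "L x = S x - C x" for x
  have L_lin: "clinear_on V L"
    by (rule clinear_onI) (simp_all add: L_def clinear_on_add[OF S_lin] clinear_on_add[OF C_lin]
        clinear_on_scaleC[OF S_lin] clinear_on_scaleC[OF C_lin] scaleC_simps)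
  have LW: "L x \<in> W" if "x \<in> V" for x
    using that by (simp add: L_def C_def Ws S mW)
  have L_bound: "norm (L x) \<le> (k * cmod (cnj w - w) + 1 + \<gamma>) * norm x" if "x \<in> V" for x
    using norm_triangle_ineq4[of "S x" "C x"] S_bound[of x] C_bound[OF that]
    by (simp add: L_def algebra_simps)
  obtain k' where k': "0 \<le> k'" "\<And>x. norm (R' x) \<le> k' * norm x"
    using bounded_clinearD(5)[OF R'(1)] by blast
  define k2 where "k2 = k' * cmod (w - z) + 1"
  have "0 < k2" using k'(1) by (simp add: k2_def add_nonneg_pos)
  have L_below: "(1 / (\<kappa> * k2)) * norm x \<le> norm (L x)" if x: "x \<in> V" for x
  proof -
    let ?n = "\<nu> x" and ?y = "L x"
    \<comment> \<open>Its components are \<open>x\<close> and \<open>C x + L x = S x\<close>, so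
      \<open>F\<close> lies in \<open>T\<close>. The resolvent at \<open>z\<close> then recovers
      \<open>\<nu> x\<close> from \<open>L x\<close> with a bound.\<close>
    define F where "F = eig z ?n + eig w ?y"
    have F: "F \<in> adjoint_op A"
      using \<nu>(1)[OF x] LW[OF x] by (simp add: F_def adj eig_in_adjoint W_def)
    have "m F = S (u F)"
      using x LW[OF x] by (simp add: F_def um_lin m_eig \<nu>(2) flip: C_def) (simp add: L_def)
    then have "F \<in> T" using T_iff[OF F] by simp
    then have "(?n + ?y, z *\<^sub>C ?n + w *\<^sub>C ?y) \<in> T"
      by (simp add: F_def eig_def)
    from R'(2)[OF this] have "?n = R' ((w - z) *\<^sub>C ?y) - ?y"
      by (simp add: scaleC_simps algebra_simps)
    then have "norm ?n \<le> norm (R' ((w - z) *\<^sub>C ?y)) + norm ?y"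
      using norm_triangle_ineq4 by metis
    also have "\<dots> \<le> k2 * norm ?y"
      using k'(2)[of "(w - z) *\<^sub>C ?y"] by (simp add: k2_def norm_scaleC distrib_right mult.assoc)
    finally have "\<kappa> * norm ?n \<le> \<kappa> * (k2 * norm ?y)"
      using \<open>\<kappa> > 0\<close> by (intro mult_left_mono) auto
    then have "norm x \<le> \<kappa> * (k2 * norm ?y)"
      using \<nu>_ge[OF x] by linarith
    then show ?thesis
      using \<open>\<kappa> > 0\<close> \<open>0 < k2\<close> by (simp add: field_simps)
  qed
  have L_onto: "\<exists>x\<in>V. L x = y" if y: "y \<in> W" for y
  proof -
    \<comment> \<open>Split \<open>eig w y\<close> into an element of \<open>T\<close> and
      \<open>eig z n\<close>. The components of the former are \<open>x\<close> and
      \<open>y - m (eig z n) = y + C x\<close>, so membership in \<open>T\<close> reads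
      \<open>S x = y + C x\<close>.\<close>
    define n where "n = y - R' ((w - z) *\<^sub>C y)"
    define x where "x = - u (eig z n)"
    have n: "n \<in> defect_space A z" "eig w y - eig z n \<in> T"
      unfolding n_def using resolvent_decomposition[OF T(3) R'(3) y[unfolded W_def]] by auto
    have x: "x \<in> V" by (simp add: x_def Vs uV)
    have "\<nu> x = - n"
      using n(1) eig_scaleC[of z "-1" n] um_lin(3)[of "-1" "eig z n"]
      by (intro \<nu>_eq x) (simp_all add: Zs x_def)
    then have Cx: "C x = - m (eig z n)"
      using eig_scaleC[of z "-1" n] um_lin(6)[of "-1" "eig z n"] by (simp add: C_def)
    have "m (eig w y - eig z n) = S (u (eig w y - eig z n))"
      using T_iff[of "eig w y - eig z n"] n(2) T(3) by blast
    then have "y - m (eig z n) = S x"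
      using y by (simp add: um_lin m_eig x_def)
    then have "L x = y" by (simp add: L_def Cx algebra_simps)
    with x show ?thesis by blast
  qed
  have "0 < 1 / (\<kappa> * k2)" using \<open>\<kappa> > 0\<close> \<open>0 < k2\<close> by simp
  from polar_decomposition_exists[OF V W L_lin LW L_bound L_below L_onto this]
  obtain \<omega> where \<omega>: "clinear_on W \<omega>" "\<omega> ` W = V"
      "\<And>y y'. y \<in> W \<Longrightarrow> y' \<in> W \<Longrightarrow> cinner (\<omega> y) (\<omega> y') = cinner y y'"
      "\<And>x. x \<in> V \<Longrightarrow> 0 \<le> inner (\<omega> (L x)) x"
    by blast
  \<comment> \<open>Split \<open>S = L + C\<close>: \<open>\<omega> (L x)\<close> contributes a
    nonnegative term, and \<open>\<omega> (C x)\<close> has norm at most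
    \<open>\<gamma> * norm x\<close> as \<open>\<omega>\<close> is isometric.\<close>
  have "(1 - \<gamma>) * (norm x)\<^sup>2 \<le> inner (x + \<omega> (S x)) x" if x: "x \<in> V" for x
  proof -
    have CW: "C x \<in> W" by (simp add: C_def mW)
    have "(norm (\<omega> (C x)))\<^sup>2 = (norm (C x))\<^sup>2"
      using \<omega>(3)[OF CW CW] unfolding cinner_self of_real_eq_iff .
    then have "norm (\<omega> (C x)) \<le> \<gamma> * norm x"
      using C_bound[OF x] by simp
    then have "norm (\<omega> (C x)) * norm x \<le> \<gamma> * norm x * norm x"
      by (intro mult_right_mono) auto
    then have "- (\<gamma> * (norm x)\<^sup>2) \<le> inner (\<omega> (C x)) x"
      using Cauchy_Schwarz_ineq2[of "\<omega> (C x)" x] by (simp add: power2_eq_square mult.assoc)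
    moreover have "\<omega> (S x) = \<omega> (L x) + \<omega> (C x)"
      using clinear_on_add[OF \<omega>(1) LW[OF x] CW] by (simp add: L_def)
    ultimately show ?thesis
      using \<omega>(4)[OF x] by (simp add: inner_simps power2_norm_eq_inner algebra_simps)
  qed
  moreover have "0 < 1 - \<gamma>" using \<gamma>(2) by simp
  ultimately show thesis
    using that[OF S_lin S(1) S_bound T_iff[unfolded u_def m_def] \<omega>(1-3)] by blast
qed

section \<open>The boundary triplet and the operator \<open>B\<close>\<close>

text \<open>The difference of two values is orthogonal to the dense domain of
  \<open>A\<close>.\<close>

lemma adjoint_op_single_valued:
  assumes "densely_defined A" "(f, f') \<in> adjoint_op A" "(f, f'') \<in> adjoint_op A"
  shows "f' = f''"
proof -
  have "closed {a. cinner a (f' - f'') = 0}"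
    by (intro closed_Collect_eq continuous_intros)
  moreover have "Domain A \<subseteq> {a. cinner a (f' - f'') = 0}"
    using assms(2,3) by (auto simp: adjoint_op_iff cinner_diff_right)
  ultimately have "closure (Domain A) \<subseteq> {a. cinner a (f' - f'') = 0}"
    by (simp add: closure_minimal)
  then have "cinner (f' - f'') (f' - f'') = 0"
    using assms(1) by (auto simp: densely_defined_def)
  then show ?thesis by (simp add: cinner_self)
qed

lemma inherited_simps [simp]:
  "carrier (inherited S) = S" "x \<oplus>\<^bsub>inherited S\<^esub> y = x + y" "c \<odot>\<^bsub>inherited S\<^esub> x = c *\<^sub>C x"
  "ip (inherited S) = cinner" "hnorm (inherited S) x = norm x"
  by (simp_all add: inherited_def hnorm_def Re_cinner norm_eq_sqrt_inner)

text \<open>The boundary space is \<open>V\<close>, to which \<open>\<omega>\<close> carries the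
  component in \<open>W\<close>. Up to scalars the boundary maps are the sum and the difference of
  the two components.\<close>

lemma almost_solvable_half_planes:
  fixes A T :: "'a::complex_hilbert operator"
  assumes A: "complex_vector.subspace A" "closed A" "symmetric_operator A" "densely_defined A"
    and T: "proper_extension A T"
    and w: "w \<in> resolvent_set T" "Im w < 0" and z: "z \<in> resolvent_set T" "0 < Im z"
  shows "almost_solvable A T"
proof -
  have T': "complex_vector.subspace T" "A \<subseteq> T" "T \<subseteq> adjoint_op A"
    using T by (auto simp: proper_extension_def linear_operator_def)
  define V where "V = defect_space A (cnj w)"
  define W where "W = defect_space A w"
  define D where "D = Domain (adjoint_op A)"
  note V = closed_csubspace_defect[of A "cnj w", folded V_def]
  note W = closed_csubspace_defect[of A w, folded W_def]
  note Vs = csubspace_simps[OF V] and Ws = csubspace_simps[OF W]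
    and adj = csubspace_simps[OF closed_csubspace_adjoint[of A]]
  have w0: "Im w \<noteq> 0" "Im (cnj w) \<noteq> 0" using w by auto
  obtain S \<omega> K c where S: "clinear_on V S" "\<And>x. x \<in> V \<Longrightarrow> S x \<in> W" "\<And>x. norm (S x) \<le> K * norm x"
    and T_iff: "\<And>F. F \<in> adjoint_op A \<Longrightarrow> F \<in> T \<longleftrightarrow> defect_component A w F = S (defect_component A (cnj w) F)"
    and \<omega>: "clinear_on W \<omega>" "\<omega> ` W = V" "\<And>y y'. y \<in> W \<Longrightarrow> y' \<in> W \<Longrightarrow> cinner (\<omega> y) (\<omega> y') = cinner y y'"
    and c: "0 < c" "\<And>x. x \<in> V \<Longrightarrow> c * (norm x)\<^sup>2 \<le> inner (x + \<omega> (S x)) x"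
    by (rule transversal_isometry_exists[OF A(1-3) T' w z, folded V_def W_def]) (rule that; assumption)
  have \<omega>V: "\<omega> y \<in> V" if "y \<in> W" for y using that \<omega>(2) by blast
  have norm_\<omega>: "norm (\<omega> y) = norm y" if "y \<in> W" for y
    using \<omega>(3)[OF that that] unfolding cinner_self of_real_eq_iff by simp
  have W': "complex_vector.subspace W" using W by (simp add: closed_csubspace_def)
  \<comment> \<open>The adjoint as a function: boundary maps take elements of the domain, whereas
    defect components take elements of the graph.\<close>
  define a where "a f = (SOME f'. (f, f') \<in> adjoint_op A)" for f
  have a: "a f = f'" if "(f, f') \<in> adjoint_op A" for f f'
    unfolding a_def by (rule some_equality[where P = "\<lambda>f'. (f, f') \<in> adjoint_op A", OF that])
      (rule adjoint_op_single_valued[OF A(4) _ that])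
  have aD: "(f, a f) \<in> adjoint_op A" if "f \<in> D" for f
    using that a by (auto simp: D_def)
  have D_add: "f + g \<in> D" "a (f + g) = a f + a g" if "f \<in> D" "g \<in> D" for f g
    using adj(2)[OF aD aD, OF that] a by (auto simp: D_def)
  have D_scaleC: "b *\<^sub>C f \<in> D" "a (b *\<^sub>C f) = b *\<^sub>C a f" if "f \<in> D" for b f
    using adj(4)[OF aD, OF that, of b] a by (auto simp: D_def scaleC_prod_def)
  define u where "u f = defect_component A (cnj w) (f, a f)" for f
  define m where "m f = \<omega> (defect_component A w (f, a f))" for f
  have uV: "u f \<in> V" and dW: "defect_component A w F \<in> W" for f F
    by (simp_all add: u_def V_def W_def defect_component_mem)
  have mV: "m f \<in> V" for f
    by (simp add: m_def \<omega>V dW)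
  have um_add: "u (f + g) = u f + u g" "m (f + g) = m f + m g" if "f \<in> D" "g \<in> D" for f g
    using that defect_component_add[of A _ "(f, a f)" "(g, a g)"]
    by (simp_all add: u_def m_def D_add dW clinear_on_add[OF \<omega>(1)])
  have um_scaleC: "u (b *\<^sub>C f) = b *\<^sub>C u f" "m (b *\<^sub>C f) = b *\<^sub>C m f" if "f \<in> D" for b f
    using that defect_component_scaleC[of A _ b "(f, a f)"]
    by (simp_all add: u_def m_def D_scaleC dW clinear_on_scaleC[OF \<omega>(1)] scaleC_prod_def)
  have green: "bform (f, a f) (g, a g) = (cnj w - w) * (cinner (u f) (u g) - cinner (m f) (m g))"
    if "f \<in> D" "g \<in> D" for f g
    using green_identity[OF A(1-3) w0(1) aD[OF that(1)] aD[OF that(2)]]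
    by (simp add: u_def m_def \<omega>(3) dW)
  have onto: "\<exists>f\<in>D. u f = x \<and> m f = y" if x: "x \<in> V" and "y \<in> V" for x y
  proof -
    obtain y' where y': "y' \<in> W" "y = \<omega> y'"
      using \<open>y \<in> V\<close> \<omega>(2) by blast
    define F where "F = eig (cnj w) x + eig w y'"
    have "F \<in> adjoint_op A"
      using x y' by (simp add: F_def adj eig_in_adjoint V_def W_def)
    then have f: "fst F \<in> D" "(fst F, a (fst F)) = F"
      using a[of "fst F" "snd F"] by (auto simp: D_def Domain_fst)
    have "defect_component A (cnj w) F = x" "defect_component A w F = y'"
      using x y'(1) w0 defect_component_eig_cnj[of A "cnj w" y']
      by (simp_all add: F_def defect_component_add V_def W_def defect_component_eig_same defect_component_eig_cnj)
    then show ?thesis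
      using f y'(2) by (intro bexI[of _ "fst F"]) (simp_all add: u_def m_def)
  qed
  \<comment> \<open>On the domain of \<open>T\<close> one has
    \<open>m f = \<omega> (S (u f))\<close>, hence \<open>u f + m f = G (u f)\<close>. Coercivity
    makes \<open>G\<close> invertible on \<open>V\<close>.\<close>
  define G where "G x = x + \<omega> (S x)" for x
  have GV: "G x \<in> V" if "x \<in> V" for x
    using that by (simp add: G_def Vs \<omega>V S(2))
  have G_lin: "clinear_on V G"
    using S(1,2) \<omega>(1) by (auto intro!: clinear_onI simp: G_def clinear_on_add clinear_on_scaleC scaleC_simps)
  have G_diff: "G (x - y) = G x - G y" if "x \<in> V" "y \<in> V" for x y
    using clinear_on_diff[OF G_lin _ that] V by (simp add: closed_csubspace_def)
  have G_below: "c * norm x \<le> norm (G x)" if "x \<in> V" for x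
  proof (cases "x = 0")
    case False
    have "c * (norm x)\<^sup>2 \<le> norm (G x) * norm x"
      using c(2)[OF that] norm_cauchy_schwarz[of "G x" x] by (simp add: G_def)
    then have "(c * norm x) * norm x \<le> norm (G x) * norm x"
      by (simp add: power2_eq_square mult.assoc)
    then show ?thesis using False by simp
  qed simp
  have G_inj: "x = y" if "x \<in> V" "y \<in> V" "G x = G y" for x y
    using G_below[of "x - y"] that c(1) by (simp add: G_diff Vs mult_le_0_iff)
  have G_onto: "\<exists>y\<in>V. G y = x" if "x \<in> V" for x
  proof (rule lax_milgram[of V G "1 + K" c])
    show "subspace V" "closed V"
      using V complex_subspace_imp_subspace by (auto simp: closed_csubspace_def)
    show "norm (G y) \<le> (1 + K) * norm y" if "y \<in> V" for y
      using norm_triangle_ineq[of y "\<omega> (S y)"] S(3)[of y]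
      by (simp add: G_def norm_\<omega> S(2) that distrib_right)
  qed (use c that in \<open>auto simp: GV G_diff G_def[symmetric]\<close>)
  define J where "J x = (SOME y. y \<in> V \<and> G y = x)" for x
  have J: "J x \<in> V" "G (J x) = x" if "x \<in> V" for x
    using someI_ex[of "\<lambda>y. y \<in> V \<and> G y = x"] G_onto[OF that] by (auto simp: J_def)
  have J_eq: "J x = y \<longleftrightarrow> G y = x" if "x \<in> V" "y \<in> V" for x y
    using J[OF that(1)] G_inj that(2) by blast
  have J_lin: "J (x + y) = J x + J y" "J (b *\<^sub>C x) = b *\<^sub>C J x" if "x \<in> V" "y \<in> V" for x y b
    using that by (simp_all add: J_eq J Vs clinear_on_add[OF G_lin] clinear_on_scaleC[OF G_lin])
  \<comment> \<open>Normalises the boundary maps: \<open>cnj w - w\<close> equals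
    \<open>2 * \<i> * (\<beta> * \<beta>)\<close>, the factor in Green's identity.\<close>
  define \<beta> where "\<beta> = complex_of_real (sqrt (- Im w))"
  have \<beta>: "\<beta> \<noteq> 0" "\<beta> * \<beta> = complex_of_real (- Im w)" "cnj \<beta> = \<beta>"
    using w by (simp_all add: \<beta>_def flip: of_real_mult)
  define \<Gamma>0 where "\<Gamma>0 f = \<beta> *\<^sub>C (u f + m f)" for f
  define \<Gamma>1 where "\<Gamma>1 f = (\<i> * \<beta>) *\<^sub>C (u f - m f)" for f
  have two: "2 *\<^sub>C x = x + x" for x :: 'a
    using scaleC_add_left[of 1 1 x] by simp
  \<comment> \<open>From \<open>u - m = 2 u - (u + m)\<close> and, on the domain of
    \<open>T\<close>, \<open>u = J (u + m)\<close>; the factor \<i> is the quotient of the scalars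
    in \<open>\<Gamma>1\<close> and \<open>\<Gamma>0\<close>.\<close>
  define B where "B x = \<i> *\<^sub>C (2 *\<^sub>C J x - x)" for x
  have "boundary_triplet A (inherited V) \<Gamma>0 \<Gamma>1"
    unfolding boundary_triplet_def D_def[symmetric]
  proof (intro conjI)
    show "hilbert_space (inherited V)"
      using V by (intro hilbert_space_inherited) (auto simp: closed_csubspace_def)
    show "linear_into (inherited V) D \<Gamma>0" "linear_into (inherited V) D \<Gamma>1"
      by (auto simp: linear_into_def \<Gamma>0_def \<Gamma>1_def Vs uV mV um_add um_scaleC scaleC_simps algebra_simps)
    show "\<forall>(f, f') \<in> adjoint_op A. \<forall>(g, g') \<in> adjoint_op A. cinner f' g - cinner f g' =
      ip (inherited V) (\<Gamma>1 f) (\<Gamma>0 g) - ip (inherited V) (\<Gamma>0 f) (\<Gamma>1 g)"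
    proof clarify
      fix f f' g g' assume fg: "(f, f') \<in> adjoint_op A" "(g, g') \<in> adjoint_op A"
      have "cinner f' g - cinner f g' = (cnj w - w) * (cinner (u f) (u g) - cinner (m f) (m g))"
        using green[of f g] fg a by (auto simp: D_def bform_def)
      also have "cnj w - w = 2 * \<i> * (\<beta> * \<beta>)"
        unfolding \<beta>(2) by (simp add: complex_eq_iff)
      also have "2 * \<i> * (\<beta> * \<beta>) * (cinner (u f) (u g) - cinner (m f) (m g)) =
        cinner (\<Gamma>1 f) (\<Gamma>0 g) - cinner (\<Gamma>0 f) (\<Gamma>1 g)"
        by (simp add: \<Gamma>0_def \<Gamma>1_def cinner_simps \<beta>(3) algebra_simps)
      finally show "cinner f' g - cinner f g' =
        ip (inherited V) (\<Gamma>1 f) (\<Gamma>0 g) - ip (inherited V) (\<Gamma>0 f) (\<Gamma>1 g)" by simp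
    qed
    show "(\<lambda>f. (\<Gamma>1 f, \<Gamma>0 f)) ` D = carrier (inherited V) \<times> carrier (inherited V)"
    proof (intro equalityI subsetI)
      fix p assume "p \<in> carrier (inherited V) \<times> carrier (inherited V)"
      then obtain x1 x0 where p: "p = (x1, x0)" "x1 \<in> V" "x0 \<in> V" by auto
      \<comment> \<open>\<open>r\<close> and \<open>s\<close> are the half sum and half difference
        of the required components \<open>u f\<close> and \<open>m f\<close>, found by solving the
        definitions of \<open>\<Gamma>0\<close> and \<open>\<Gamma>1\<close>.\<close>
      define r where "r = (1 / (2 * \<beta>)) *\<^sub>C x0"
      define s where "s = (- \<i> / (2 * \<beta>)) *\<^sub>C x1"
      obtain f where f: "f \<in> D" "u f = r + s" "m f = r - s"
        using onto[of "r + s" "r - s"] p Vs by (auto simp: r_def s_def)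
      have "u f + m f = 2 *\<^sub>C r" "u f - m f = 2 *\<^sub>C s"
        by (simp_all add: f two)
      then have "\<Gamma>0 f = x0" "\<Gamma>1 f = x1"
        using \<beta>(1) by (simp_all add: \<Gamma>0_def \<Gamma>1_def r_def s_def scaleC_scaleC)
      then have "p = (\<Gamma>1 f, \<Gamma>0 f)" by (simp add: p(1))
      with f(1) show "p \<in> (\<lambda>f. (\<Gamma>1 f, \<Gamma>0 f)) ` D" by blast
    qed (auto simp: \<Gamma>0_def \<Gamma>1_def Vs uV mV)
  qed
  moreover have "bounded_operator_on (inherited V) B"
    unfolding bounded_operator_on_def
  proof (intro conjI)
    show "\<exists>K. \<forall>x\<in>carrier (inherited V). hnorm (inherited V) (B x) \<le> K * hnorm (inherited V) x"
    proof (intro exI ballI)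
      fix x assume "x \<in> carrier (inherited V)"
      then have x: "x \<in> V" by simp
      have "norm (J x) \<le> norm x / c"
        using G_below[OF J(1)[OF x]] c(1) by (simp add: J(2)[OF x] field_simps)
      moreover have "norm (B x) \<le> 2 * norm (J x) + norm x"
        using norm_triangle_ineq4[of "2 *\<^sub>C J x" x] by (simp add: B_def norm_scaleC)
      ultimately show "hnorm (inherited V) (B x) \<le> (2 / c + 1) * hnorm (inherited V) x"
        by (simp add: distrib_right)
    qed
  qed (auto simp: B_def Vs J J_lin scaleC_simps algebra_simps)
  moreover have "Domain T = {f \<in> D. \<Gamma>1 f = B (\<Gamma>0 f)}"
  proof -
    have "f \<in> Domain T \<longleftrightarrow> \<Gamma>1 f = B (\<Gamma>0 f)" if f: "f \<in> D" for f
    proof -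
      have "f \<in> Domain T \<longleftrightarrow> (f, a f) \<in> T"
        using T'(3) a by auto
      also have "\<dots> \<longleftrightarrow> defect_component A w (f, a f) = S (u f)"
        using T_iff[OF aD[OF f]] by (simp add: u_def)
      also have "\<dots> \<longleftrightarrow> m f = \<omega> (S (u f))"
      proof
        \<comment> \<open>Cancelling \<open>\<omega>\<close> is possible because it is linear and
          isometric on \<open>W\<close>.\<close>
        assume "m f = \<omega> (S (u f))"
        then have "\<omega> (defect_component A w (f, a f) - S (u f)) = 0"
          using clinear_on_diff[OF \<omega>(1) W' dW S(2)[OF uV]] by (simp add: m_def)
        then show "defect_component A w (f, a f) = S (u f)"
          using norm_\<omega>[of "defect_component A w (f, a f) - S (u f)"] by (simp add: Ws dW S(2) uV)
      qed (simp add: m_def)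
      also have "\<dots> \<longleftrightarrow> J (u f + m f) = u f"
        using J_eq[of "u f + m f" "u f"] by (auto simp: Vs uV mV G_def)
      also have "\<dots> \<longleftrightarrow> \<Gamma>1 f = B (\<Gamma>0 f)"
      proof -
        let ?j = "J (u f + m f)"
        have t: "u f + m f \<in> V" by (simp add: Vs uV mV)
        have "B (\<Gamma>0 f) = (\<i> * \<beta>) *\<^sub>C (2 *\<^sub>C ?j - (u f + m f))"
          by (simp only: B_def \<Gamma>0_def J_lin(2)[OF t t] complex_vector.scale_right_diff_distrib scaleC_scaleC mult_ac)
        also have "2 *\<^sub>C ?j - (u f + m f) = (u f - m f) + 2 *\<^sub>C (?j - u f)"
          unfolding two by simp
        finally have "B (\<Gamma>0 f) = \<Gamma>1 f + (\<i> * \<beta>) *\<^sub>C 2 *\<^sub>C (?j - u f)"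
          by (simp only: \<Gamma>1_def scaleC_add_right)
        then show ?thesis using \<beta>(1) by simp
      qed
      finally show ?thesis .
    qed
    moreover have "Domain T \<subseteq> D" using T'(3) by (auto simp: D_def)
    ultimately show ?thesis by blast
  qed
  ultimately have "solves A T (inherited V) \<Gamma>0 \<Gamma>1 B"
    by (simp add: solves_def D_def)
  with T show ?thesis by (rule almost_solvableI)
qed

theorem proposition2p8:
  fixes A T :: "'a::complex_hilbert operator" and z1 z2 :: complex
  assumes "separable_space (euclidean :: 'a topology)"
    and "linear_operator A" and "closed A" and "densely_defined A" and "symmetric_operator A"
    and "deficiency_index_plus A = deficiency_index_minus A"
    and "proper_extension A T"
    and "z1 \<in> resolvent_set T" and "z2 \<in> resolvent_set T"
    and "Im z1 * Im z2 < 0"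
  shows "almost_solvable A T"
proof -
  have A: "complex_vector.subspace A"
    using assms(2) by (simp add: linear_operator_def)
  \<comment> \<open>One point lies in each open half-plane; the one in the lower half-plane serves
    as \<open>w\<close>.\<close>
  consider "Im z1 < 0" "0 < Im z2" | "Im z2 < 0" "0 < Im z1"
    using assms(10) by (auto simp: mult_less_0_iff)
  then show ?thesis
    using almost_solvable_half_planes[OF A assms(3,5,4,7)] assms(8,9) by cases
qed

end
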